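(* Let $\mathcal{M}$ be a moon polyomino with $m$ columns, $\mathbf{s}$ an $m$-tuple of nonnegative integers, $A$ a subset of the rows of $\mathcal{M}$, and let $\mathcal{N}$, $\mathbf{s}'$ and $g$ be as defined in the context. The map $g:\mathbf{F}(\mathcal{M},\mathbf{s};A)\to\mathbf{F}(\mathcal{N},\mathbf{s}';A)$ is a bijection and $\mathrm{ne}(M)=\mathrm{ne}(g(M))$ for every $M\in\mathbf{F}(\mathcal{M},\mathbf{s};A)$.
   Context: **Polyominoes.** A polyomino is a finite subset of $\mathbb{Z}^2$ whose elements are drawn as square cells. It is convex if its intersection with any row or column is connected, and intersection-free if any two of its columns are comparable, i.e. the set of row-coordinates of one is contained in that of the other. A moon polyomino is a convex intersection-free polyomino. A moon polyomino whose rows are left-aligned is a left-aligned stack polyomino. Columns are labelled $c_1,\dots,c_m$ from left to right. **Fillings.** A filling of a moon polyomino $\mathcal{M}$ assigns $0$ or $1$ to each cell with at most one $1$ in each row; a 1-cell is a cell assigned $1$; a row is empty if it contains no 1-cell. $\mathbf{F}(\mathcal{M},\mathbf{s};A)$ is the set of fillings of $\mathcal{M}$ whose empty rows are exactly those in $A$ and in which column $c_i$ has exactly $s_i$ 1's for each $i$. An NE chain is a pair of 1-cells, one strictly above and strictly to the right of the other, such that the smallest rectangle containing them is contained in $\mathcal{M}$; $\mathrm{ne}(M)$ is the number of NE chains. **Algorithm $\alpha$.** Set $\mathcal{M}'=\mathcal{M}$. While $\mathcal{M}'$ is not left-aligned, let $\mathcal{R}$ be the largest rectangle contained in $\mathcal{M}'$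 that contains the leftmost column of $\mathcal{M}'$, and replace $\mathcal{M}'$ by the polyomino obtained by moving this leftmost column (keeping its row-coordinates) to the right end of $\mathcal{R}$. The final $\mathcal{M}'$ is $\mathcal{N}$, the left-aligned stack polyomino with the same row lengths as $\mathcal{M}$ from top to bottom. $\mathbf{s}'$ is $\mathbf{s}$ rearranged in the same way as the columns. **The map $g$.** Perform $\alpha$ on $\mathcal{M}$ together with the filling; at each step, change the filling $R$ of $\mathcal{R}$ as follows, leaving 1's outside $\mathcal{R}$ in their rows and in their (moved) columns. Let $C_1,\dots,C_k$ be the 1-cells of the first column of $R$ from top to bottom. Shade the empty rows of $R$ and the cells of $R$ to the right of $C_1,\dots,C_k$. Let $l_i$ be the number of empty white (unshaded) cells in the first column above $C_i$. On the rectangle $\mathcal{R}'$ obtained by moving the first column to the last place, define the new filling $R'$: (1) the rows that were empty remain empty; shade them; (2) write $k$ 1's in the last column, in unshaded rows, so that there are $l_i$ white empty cells of that column below the $i$-th 1 counted from the bottom, $1\le i\le k$; (3) shade the cells to the left of these 1's; (4) fill the remaining unshaded rows so that the unshaded part of $R'$ to the left of the last column is the same as the unshaded part of $R$ to the right of the first column. $g(M)$ is the resulting filling of $\mathcal{N}$. *)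

theory Defs
  imports Main "HOL-Library.FuncSet" "HOL-Library.While_Combinator"
begin

section \<open>Moon polyominoes\<close>

text \<open>A cell is a pair (x, y): x is the coordinate of its column, increasing to the right (east),
  and y the coordinate of its row, increasing upwards (north). Rows are identified with their
  coordinates.\<close>

type_synonym cell = "int \<times> int"

definition row_coords :: "cell set \<Rightarrow> int set" where
  "row_coords P = snd ` P"

definition col_coords :: "cell set \<Rightarrow> int set" where
  "col_coords P = fst ` P"

definition col :: "cell set \<Rightarrow> int \<Rightarrow> int set" where
  "col P x = {y. (x, y) \<in> P}"

definition convex_polyomino :: "cell set \<Rightarrow> bool" where
  "convex_polyomino P \<longleftrightarrow>
     (\<forall>y x1 x2 x3. (x1, y) \<in> P \<and> (x3, y) \<in> P \<and> x1 \<le> x2 \<and> x2 \<le> x3 \<longrightarrow> (x2, y) \<in> P) \<and>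
     (\<forall>x y1 y2 y3. (x, y1) \<in> P \<and> (x, y3) \<in> P \<and> y1 \<le> y2 \<and> y2 \<le> y3 \<longrightarrow> (x, y2) \<in> P)"

definition intersection_free :: "cell set \<Rightarrow> bool" where
  "intersection_free P \<longleftrightarrow>
     (\<forall>x\<in>col_coords P. \<forall>x'\<in>col_coords P. col P x \<subseteq> col P x' \<or> col P x' \<subseteq> col P x)"

definition moon_polyomino :: "cell set \<Rightarrow> bool" where
  "moon_polyomino P \<longleftrightarrow> finite P \<and> convex_polyomino P \<and> intersection_free P"

definition leftmost :: "cell set \<Rightarrow> int" where
  "leftmost P = Min (col_coords P)"

definition left_aligned :: "cell set \<Rightarrow> bool" where
  "left_aligned P \<longleftrightarrow> (\<forall>y\<in>row_coords P. (leftmost P, y) \<in> P)"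


section \<open>Fillings\<close>

definition one_cells :: "cell set \<Rightarrow> (cell \<Rightarrow> nat) \<Rightarrow> cell set" where
  "one_cells P F = {c \<in> P. F c = 1}"

text \<open>Fillings are extensional functions on the cells, so that distinct functions
  are distinct fillings.\<close>

definition fillings :: "cell set \<Rightarrow> (cell \<Rightarrow> nat) set" where
  "fillings P = {F \<in> P \<rightarrow>\<^sub>E {0, 1}. \<forall>y. card {x. (x, y) \<in> one_cells P F} \<le> 1}"

definition filling_of :: "cell set \<Rightarrow> cell set \<Rightarrow> cell \<Rightarrow> nat" where
  "filling_of P S = (\<lambda>c\<in>P. if c \<in> S then 1 else 0)"

definition empty_rows :: "cell set \<Rightarrow> (cell \<Rightarrow> nat) \<Rightarrow> int set" where
  "empty_rows P F = {y \<in> row_coords P. \<forall>x. (x, y) \<notin> one_cells P F}"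

text \<open>The nonempty columns of a moon polyomino have consecutive coordinates, so the
  column \<open>c\<^sub>i\<^sub>+\<^sub>1\<close> has coordinate \<open>leftmost P + i\<close>; the prescribed number of 1's in it
  is \<open>s ! i\<close>.\<close>

definition F_set :: "cell set \<Rightarrow> nat list \<Rightarrow> int set \<Rightarrow> (cell \<Rightarrow> nat) set" where
  "F_set P s A = {F \<in> fillings P. empty_rows P F = A \<and>
     (\<forall>i < card (col_coords P). card {y. (leftmost P + int i, y) \<in> one_cells P F} = s ! i)}"

definition ne_chains :: "cell set \<Rightarrow> (cell \<Rightarrow> nat) \<Rightarrow> (cell \<times> cell) set" where
  "ne_chains P F = {((x1, y1), (x2, y2)) | x1 y1 x2 y2.
     (x1, y1) \<in> one_cells P F \<and> (x2, y2) \<in> one_cells P F \<and> x1 < x2 \<and> y1 < y2 \<and>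
     {x1..x2} \<times> {y1..y2} \<subseteq> P}"

definition ne :: "cell set \<Rightarrow> (cell \<Rightarrow> nat) \<Rightarrow> nat" where
  "ne P F = card (ne_chains P F)"


section \<open>The algorithm \<open>\<alpha>\<close>\<close>

definition is_rectangle :: "cell set \<Rightarrow> bool" where
  "is_rectangle R \<longleftrightarrow> (\<exists>x1 x2 y1 y2. R = {x1..x2} \<times> {y1..y2})"

text \<open>Every competing rectangle has exactly the rows of the leftmost column, so that the largest
  one is the greatest with respect to inclusion.\<close>

definition lead_rect :: "cell set \<Rightarrow> cell set" where
  "lead_rect P = (GREATEST R. is_rectangle R \<and> R \<subseteq> P \<and> {leftmost P} \<times> col P (leftmost P) \<subseteq> R)"

definition rect_end :: "cell set \<Rightarrow> int" where
  "rect_end P = Max (col_coords (lead_rect P))"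

text \<open>The leftmost column takes the place of the last column of the rectangle, whose other
  columns shift one place to the left; the columns beyond the rectangle stay.\<close>

definition move_cell :: "cell set \<Rightarrow> cell \<Rightarrow> cell" where
  "move_cell P = (\<lambda>(x, y).
     (if x = leftmost P then rect_end P
      else if leftmost P < x \<and> x \<le> rect_end P then x - 1
      else x, y))"

definition alpha_step :: "cell set \<Rightarrow> cell set" where
  "alpha_step P = move_cell P ` P"

definition alpha_step_seq :: "cell set \<Rightarrow> nat list \<Rightarrow> nat list" where
  "alpha_step_seq P s =
     (let w = card (col_coords (lead_rect P)) in rotate1 (take w s) @ drop w s)"

definition alpha :: "cell set \<Rightarrow> cell set" where
  "alpha P = while (\<lambda>P'. \<not> left_aligned P') alpha_step P"

definition alpha_seq :: "cell set \<Rightarrow> nat list \<Rightarrow> nat list" where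
  "alpha_seq P s = snd (while (\<lambda>(P', s'). \<not> left_aligned P')
     (\<lambda>(P', s'). (alpha_step P', alpha_step_seq P' s')) (P, s))"


section \<open>The map \<open>g\<close>\<close>

text \<open>In the next two definitions, \<open>Y\<close> is the set of nonempty rows of the filling \<open>R\<close>, and \<open>K\<close> the
  set of those whose 1 is in the first column. The white empty cells of the first column are
  the ones in the rows \<open>Y - K\<close>. Indices start from 0, so \<open>white_above Y K i\<close> is the number
  \<open>l\<^sub>i\<^sub>+\<^sub>1\<close>.\<close>

definition white_above :: "int set \<Rightarrow> int set \<Rightarrow> nat \<Rightarrow> nat" where
  "white_above Y K i = card {y \<in> Y - K. y > rev (sorted_list_of_set K) ! i}"

definition new_last_column :: "int set \<Rightarrow> int set \<Rightarrow> int set" where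
  "new_last_column Y K = (THE K'. K' \<subseteq> Y \<and> card K' = card K \<and>
     (\<forall>i < card K. card {y \<in> Y - K'. y < sorted_list_of_set K' ! i} = white_above Y K i))"

text \<open>The rectangle has the columns \<open>a, \<dots>, b\<close>, and \<open>S\<close> is the set of its 1-cells. The unshaded
  part to the right of the first column is copied row by row, in the same vertical order, to the
  unshaded part to the left of the last column. Shaded cells get no 1's.\<close>

definition new_rect_ones :: "int \<Rightarrow> int \<Rightarrow> cell set \<Rightarrow> cell set" where
  "new_rect_ones a b S =
     (let Y = row_coords S;
          K = col S a;
          K' = new_last_column Y K;
          U = sorted_list_of_set (Y - K);
          U' = sorted_list_of_set (Y - K')
      in {b} \<times> K' \<union>
         {(x - 1, U' ! j) | x j. a < x \<and> x \<le> b \<and> j < length U \<and> (x, U ! j) \<in> S})"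

definition g_step :: "cell set \<Rightarrow> (cell \<Rightarrow> nat) \<Rightarrow> cell \<Rightarrow> nat" where
  "g_step P F =
     (let R = lead_rect P; S = one_cells P F
      in filling_of (alpha_step P)
           (move_cell P ` (S - R) \<union> new_rect_ones (leftmost P) (rect_end P) (S \<inter> R)))"

definition g_map :: "cell set \<Rightarrow> (cell \<Rightarrow> nat) \<Rightarrow> cell \<Rightarrow> nat" where
  "g_map P F = snd (while (\<lambda>(P', F'). \<not> left_aligned P')
     (\<lambda>(P', F'). (alpha_step P', g_step P' F')) (P, F))"

end

theory Submission
  imports Defs
begin

text \<open>One step of the algorithm shifts the rows outside the set \<open>I\<close> of rows of the
  leftmost column one place to the left and fixes those in \<open>I\<close>. If \<open>Y\<close> is the set of nonempty rows of the rectangle and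
  \<open>K \<subseteq> Y\<close> the set of rows with a 1 in its first column, then \<open>K'\<close> is the image of \<open>K\<close> under the order
  reversal of \<open>Y\<close>, an involution; hence the step is a bijection whose inverse is the mirrored step.
  On the 1-cells the step is an injective map sending each cell to its moved column and permuting
  the rows in \<open>Y\<close>. By convexity two 1-cells \<open>(x1, y1)\<close>, \<open>(x2, y2)\<close> with \<open>x1 < x2\<close> and \<open>y1 < y2\<close>
  form a chain iff \<open>(x1, y2)\<close> and \<open>(x2, y1)\<close> are cells. The map preserves this relation except for
  pairs from the rectangle to a 1 on its right in a row of \<open>I\<close>, which are counted by rows, and
  pairs involving the moved column, which are matched by the order reversal of \<open>Y\<close>.\<close>

section \<open>Order isomorphisms and order reversal of finite sets\<close>

lemma card_less_nth_sorted:
  fixes A :: "'a::linorder set"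
  assumes "finite A" "i < card A"
  shows "card {z \<in> A. z < sorted_list_of_set A ! i} = i"
proof -
  let ?L = "sorted_list_of_set A"
  have L: "length ?L = card A" "sorted_wrt (<) ?L" "set ?L = A"
    using assms by auto
  have "{z \<in> A. z < ?L ! i} = (!) ?L ` {..<i}"
  proof (intro equalityI subsetI)
    fix z assume "z \<in> {z \<in> A. z < ?L ! i}"
    then obtain j where j: "j < card A" "z = ?L ! j" "z < ?L ! i"
      using L by (metis (no_types, lifting) in_set_conv_nth mem_Collect_eq)
    then have "j < i"
      using L sorted_wrt_nth_less[OF L(2), of i j] assms(2)
      by (metis linorder_neqE_nat order_less_asym order_less_irrefl)
    then show "z \<in> (!) ?L ` {..<i}" using j by auto
  next
    fix z assume "z \<in> (!) ?L ` {..<i}"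
    then show "z \<in> {z \<in> A. z < ?L ! i}"
      using L sorted_wrt_nth_less[OF L(2)] assms(2) by (force simp: set_conv_nth)
  qed
  moreover have "inj_on ((!) ?L) {..<i}"
    using L assms by (auto simp: inj_on_def nth_eq_iff_index_eq)
  ultimately show ?thesis by (simp add: card_image)
qed

lemma ex_nth_sorted:
  assumes "finite A" "y \<in> A"
  obtains i where "i < card A" "y = sorted_list_of_set A ! i"
  using assms by (metis in_set_conv_nth length_sorted_list_of_set set_sorted_list_of_set)

lemma nth_sorted_in:
  assumes "finite A" "i < card A"
  shows "sorted_list_of_set A ! i \<in> A"
  using assms by (metis length_sorted_list_of_set nth_mem set_sorted_list_of_set)

lemma nth_sorted_less_iff:
  fixes A :: "'a::linorder set"
  assumes "finite A" "i < card A" "j < card A"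
  shows "sorted_list_of_set A ! i < sorted_list_of_set A ! j \<longleftrightarrow> i < j"
  using assms sorted_wrt_nth_less[of "(<)" "sorted_list_of_set A"]
  by (metis length_sorted_list_of_set linorder_neqE_nat order_less_asym order_less_irrefl
      strict_sorted_list_of_set)

definition ord_iso :: "'a::linorder set \<Rightarrow> 'a set \<Rightarrow> 'a \<Rightarrow> 'a" where
  "ord_iso A B y = sorted_list_of_set B ! card {z \<in> A. z < y}"

definition ord_rev :: "'a::linorder set \<Rightarrow> 'a \<Rightarrow> 'a" where
  "ord_rev A y = sorted_list_of_set A ! (card A - 1 - card {z \<in> A. z < y})"

lemma ord_iso_nth:
  "finite A \<Longrightarrow> i < card A \<Longrightarrow> ord_iso A B (sorted_list_of_set A ! i) = sorted_list_of_set B ! i"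
  by (simp add: ord_iso_def card_less_nth_sorted)

lemma ord_rev_nth:
  "finite A \<Longrightarrow> i < card A \<Longrightarrow>
    ord_rev A (sorted_list_of_set A ! i) = sorted_list_of_set A ! (card A - 1 - i)"
  by (simp add: ord_rev_def card_less_nth_sorted)

context
  fixes A B :: "'a::linorder set"
  assumes fin: "finite A" "finite B" and card_eq: "card A = card B"
begin

lemma ord_iso_in: "y \<in> A \<Longrightarrow> ord_iso A B y \<in> B"
  by (metis card_eq ex_nth_sorted fin nth_sorted_in ord_iso_nth)

lemma ord_iso_less_iff:
  "y \<in> A \<Longrightarrow> z \<in> A \<Longrightarrow> ord_iso A B y < ord_iso A B z \<longleftrightarrow> y < z"
  by (elim ex_nth_sorted[OF fin(1)])
    (use fin card_eq in \<open>simp add: ord_iso_nth nth_sorted_less_iff\<close>)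

lemma ord_iso_inverse: "y \<in> A \<Longrightarrow> ord_iso B A (ord_iso A B y) = y"
  by (elim ex_nth_sorted[OF fin(1)])
    (use fin card_eq in \<open>simp add: ord_iso_nth\<close>)

end

context
  fixes A :: "'a::linorder set"
  assumes fin: "finite A"
begin

lemma ord_rev_in: "y \<in> A \<Longrightarrow> ord_rev A y \<in> A"
  by (elim ex_nth_sorted[OF fin]) (simp add: ord_rev_nth nth_sorted_in fin)

lemma ord_rev_inverse: "y \<in> A \<Longrightarrow> ord_rev A (ord_rev A y) = y"
  by (elim ex_nth_sorted[OF fin]) (simp add: ord_rev_nth fin)

lemma ord_rev_less_iff:
  "y \<in> A \<Longrightarrow> z \<in> A \<Longrightarrow> ord_rev A y < ord_rev A z \<longleftrightarrow> z < y"
  by (elim ex_nth_sorted[OF fin]) (simp add: ord_rev_nth nth_sorted_less_iff fin, linarith)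

lemma inj_on_ord_rev: "B \<subseteq> A \<Longrightarrow> inj_on (ord_rev A) B"
  by (metis inj_on_def ord_rev_inverse subset_eq)

lemma ord_rev_image_subset: "B \<subseteq> A \<Longrightarrow> ord_rev A ` B \<subseteq> A"
  using ord_rev_in by blast

lemma ord_rev_image_image: "B \<subseteq> A \<Longrightarrow> ord_rev A ` ord_rev A ` B = B"
  by (force simp: image_image ord_rev_inverse subset_iff)

lemma ord_rev_mem_image_iff: "B \<subseteq> A \<Longrightarrow> y \<in> A \<Longrightarrow> ord_rev A y \<in> ord_rev A ` B \<longleftrightarrow> y \<in> B"
  by (metis (no_types, lifting) imageE imageI ord_rev_inverse subsetD)

lemma card_Diff_ord_rev: "B \<subseteq> A \<Longrightarrow> card (A - ord_rev A ` B) = card (A - B)"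
  by (metis card_Diff_subset card_image fin finite_imageI finite_subset inj_on_ord_rev
      ord_rev_image_subset)

end

section \<open>The new last column as the reversal of the old first column\<close>

lemma sorted_list_of_set_ord_rev:
  fixes Y :: "'a::linorder set"
  assumes "finite Y" "K \<subseteq> Y"
  shows "sorted_list_of_set (ord_rev Y ` K) = map (ord_rev Y) (rev (sorted_list_of_set K))"
proof -
  have fK: "finite K" using assms finite_subset by auto
  let ?L = "sorted_list_of_set K"
  have "sorted_wrt (<) (map (ord_rev Y) (rev ?L))"
    unfolding sorted_wrt_map sorted_wrt_rev
    by (rule sorted_wrt_mono_rel[OF _ strict_sorted_list_of_set])
      (use assms fK in \<open>auto simp: ord_rev_less_iff[OF assms(1)] subset_iff\<close>)
  moreover have "set (map (ord_rev Y) (rev ?L)) = ord_rev Y ` K" using fK by simp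
  ultimately show ?thesis
    using fK strict_sorted_equal[of "map (ord_rev Y) (rev ?L)" "sorted_list_of_set (ord_rev Y ` K)"]
    by (simp add: strict_sorted_equal)
qed

text \<open>Reversing the order of \<open>Y\<close> turns the i-th 1 from the top into the i-th 1
  from the bottom, and the white cells above it into white cells below, so the reversed image fits
  the description. It is the only one that does, since the description fixes the rank of each 1
  within \<open>Y\<close>.\<close>

lemma new_last_column_eq:
  assumes Y: "finite Y" "K \<subseteq> Y"
  shows "new_last_column Y K = ord_rev Y ` K"
proof -
  let ?K = "ord_rev Y ` K"
  let ?Q = "\<lambda>K'. K' \<subseteq> Y \<and> card K' = card K \<and>
     (\<forall>i < card K. card {y \<in> Y - K'. y < sorted_list_of_set K' ! i} = white_above Y K i)"
  have fK: "finite K" using Y finite_subset by auto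
  have ex: "?Q ?K"
  proof (intro conjI allI impI)
    show "?K \<subseteq> Y" using Y by (rule ord_rev_image_subset)
    show "card ?K = card K" using Y by (simp add: card_image inj_on_ord_rev)
    fix i assume i: "i < card K"
    let ?k = "rev (sorted_list_of_set K) ! i"
    have k: "?k \<in> Y"
      using i fK Y(2) nth_mem[of i "rev (sorted_list_of_set K)"] by auto
    have "sorted_list_of_set ?K ! i = ord_rev Y ?k"
      using i fK Y by (simp add: sorted_list_of_set_ord_rev)
    moreover have "{y \<in> Y - ?K. y < ord_rev Y ?k} = ord_rev Y ` {y \<in> Y - K. y > ?k}"
    proof (intro equalityI subsetI)
      fix y assume y: "y \<in> {y \<in> Y - ?K. y < ord_rev Y ?k}"
      then have "ord_rev Y y \<in> {y \<in> Y - K. y > ?k}"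
        using ord_rev_less_iff[OF Y(1), of "ord_rev Y y" ?k] ord_rev_in[OF Y(1)] k
        by (auto simp: ord_rev_inverse[OF Y(1)]) (metis Y(1) imageI ord_rev_inverse)
      then show "y \<in> ord_rev Y ` {y \<in> Y - K. y > ?k}"
        using y ord_rev_inverse[OF Y(1), of y] by (metis (no_types, lifting) DiffD1 imageI mem_Collect_eq)
    next
      fix y assume "y \<in> ord_rev Y ` {y \<in> Y - K. y > ?k}"
      then show "y \<in> {y \<in> Y - ?K. y < ord_rev Y ?k}"
        using k Y by (auto simp: ord_rev_in ord_rev_less_iff) (metis ord_rev_inverse subsetD)
    qed
    ultimately show "card {y \<in> Y - ?K. y < sorted_list_of_set ?K ! i} = white_above Y K i"
      using Y by (simp add: white_above_def card_image inj_on_ord_rev subset_iff)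
  qed
  have uniq: "K1 = K2" if Q1: "?Q K1" and Q2: "?Q K2" for K1 K2
  proof -
    \<comment> \<open>The rows of \<open>Y\<close> below the 1 of index \<open>i\<close> are the
      prescribed white ones and the \<open>i\<close> smaller elements of \<open>K'\<close>. This
      rank determines the element of \<open>Y\<close>.\<close>
    have *: "card {y \<in> Y. y < sorted_list_of_set K' ! i} = white_above Y K i + i"
      if Q: "?Q K'" and i: "i < card K" for K' i
    proof -
      have f: "finite K'" using Q Y finite_subset by blast
      have "{y \<in> Y. y < sorted_list_of_set K' ! i} =
          {y \<in> Y - K'. y < sorted_list_of_set K' ! i} \<union> {y \<in> K'. y < sorted_list_of_set K' ! i}"
        using Q by auto
      then have "card {y \<in> Y. y < sorted_list_of_set K' ! i} =
          card {y \<in> Y - K'. y < sorted_list_of_set K' ! i} + card {y \<in> K'. y < sorted_list_of_set K' ! i}"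
        using Y(1) f by (simp add: card_Un_disjoint disjoint_iff)
      then show ?thesis using Q i f card_less_nth_sorted[of K' i] by simp
    qed
    have nth: "sorted_list_of_set K' ! i = sorted_list_of_set Y ! (white_above Y K i + i)"
      if Q: "?Q K'" and i: "i < card K" for K' i
    proof -
      have "finite K'" using Q Y finite_subset by blast
      then have "sorted_list_of_set K' ! i \<in> Y" using Q i nth_sorted_in[of K' i] by auto
      then show ?thesis using *[OF Q i]
        by (metis Y(1) card_less_nth_sorted ex_nth_sorted)
    qed
    have "sorted_list_of_set K1 = sorted_list_of_set K2"
      using nth[OF Q1] nth[OF Q2] Q1 Q2 by (intro nth_equalityI) auto
    then show ?thesis
      using Q1 Q2 Y(1) by (metis finite_subset set_sorted_list_of_set)
  qed
  show ?thesis
    unfolding new_last_column_def using ex uniq by (intro the_equality) blast+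
qed


section \<open>Moving a column, as a map on sets of 1-cells\<close>

text \<open>The effect of the step on rows. Being the identity off \<open>Y\<close>, it permutes all
  integers and also applies to 1's outside the rectangle; \<open>ord_iso\<close> is the copying of
  the unshaded part in vertical order.\<close>

definition row_perm :: "int set \<Rightarrow> int set \<Rightarrow> int \<Rightarrow> int" where
  "row_perm Y K y =
     (if y \<notin> Y then y else if y \<in> K then ord_rev Y y else ord_iso (Y - K) (Y - ord_rev Y ` K) y)"

lemma row_perm_less_iff:
  assumes "finite Y" "K \<subseteq> Y" "y \<in> Y - K" "z \<in> Y - K"
  shows "row_perm Y K y < row_perm Y K z \<longleftrightarrow> y < z"
  using assms ord_iso_less_iff[of "Y - K" "Y - ord_rev Y ` K" y z]
  by (simp add: row_perm_def card_Diff_ord_rev)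

context
  fixes Y K :: "int set"
  assumes fin: "finite Y" and sub: "K \<subseteq> Y"
begin

lemma ord_iso_Diff_in: "y \<in> Y - K \<Longrightarrow> ord_iso (Y - K) (Y - ord_rev Y ` K) y \<in> Y - ord_rev Y ` K"
  by (rule ord_iso_in) (use fin sub in \<open>auto simp: card_Diff_ord_rev\<close>)

lemma row_perm_mem_iff: "row_perm Y K y \<in> Y \<longleftrightarrow> y \<in> Y"
  using ord_iso_Diff_in[of y] ord_rev_in[OF fin, of y] by (auto simp: row_perm_def)

lemma row_perm_mem_image_iff: "row_perm Y K y \<in> ord_rev Y ` K \<longleftrightarrow> y \<in> K"
  using ord_iso_Diff_in[of y] ord_rev_image_subset[OF fin sub] sub by (auto simp: row_perm_def)

text \<open>The inverse has the same shape, because \<open>ord_rev\<close> is an involution on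
  \<open>Y\<close> and exchanging the two sets inverts \<open>ord_iso\<close>. This lets the
  mirrored step serve as the inverse.\<close>

lemma row_perm_inverse: "row_perm Y (ord_rev Y ` K) (row_perm Y K y) = y"
proof -
  consider "y \<notin> Y" | "y \<in> K" | "y \<in> Y - K" by auto
  then show ?thesis
  proof cases
    case 1 then show ?thesis by (simp add: row_perm_def)
  next
    case 2 then show ?thesis
      using sub ord_rev_in[OF fin, of y] ord_rev_inverse[OF fin, of y] by (auto simp: row_perm_def)
  next
    case 3
    have "ord_iso (Y - ord_rev Y ` K) (Y - K) (ord_iso (Y - K) (Y - ord_rev Y ` K) y) = y"
      by (rule ord_iso_inverse) (use fin sub 3 in \<open>auto simp: card_Diff_ord_rev\<close>)
    then show ?thesis
      using 3 ord_iso_Diff_in[of y] by (simp add: row_perm_def ord_rev_image_image[OF fin sub])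
  qed
qed

lemma inj_row_perm: "inj (row_perm Y K)"
  by (metis injI row_perm_inverse)

end

lemma row_perm_inverse_image:
  assumes "finite Y" "K \<subseteq> Y"
  shows "row_perm Y K (row_perm Y (ord_rev Y ` K) y) = y"
  using row_perm_inverse[of Y "ord_rev Y ` K" y] assms
  by (simp add: ord_rev_image_image ord_rev_image_subset)

text \<open>The permutation and its inverse both map \<open>Z\<close> into itself. Later
  \<open>Z\<close> is either \<open>Y\<close> or the set of all nonempty rows.\<close>

lemma row_perm_image:
  assumes "finite Y" "K \<subseteq> Y" "Y \<subseteq> Z"
  shows "row_perm Y K ` Z = Z"
proof -
  have *: "row_perm Y K' y \<in> Z" if "K' \<subseteq> Y" "y \<in> Z" for y K'
    using that assms row_perm_mem_iff[of Y K' y] by (cases "y \<in> Y") (auto simp: row_perm_def)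
  show ?thesis
    using *[of K] *[of "ord_rev Y ` K"] assms ord_rev_image_subset[of Y K]
    by (auto simp: image_iff) (metis row_perm_inverse_image)
qed

lemma row_perm_image_first:
  assumes "finite Y" "K \<subseteq> Y"
  shows "row_perm Y K ` K = ord_rev Y ` K"
  using assms(2) by (intro image_cong) (auto simp: row_perm_def)

section \<open>Maps of 1-cells that move one column of a rectangle\<close>

definition one_per_row :: "cell set \<Rightarrow> bool" where
  "one_per_row S \<longleftrightarrow> (\<forall>x x' y. (x, y) \<in> S \<longrightarrow> (x', y) \<in> S \<longrightarrow> x = x')"

lemma one_per_rowD: "one_per_row S \<Longrightarrow> (x, y) \<in> S \<Longrightarrow> (x', y) \<in> S \<Longrightarrow> x = x'"
  unfolding one_per_row_def by blast

text \<open>With at most one 1 per row, the row alone can select the case: a 1 in a row of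
  \<open>I\<close> outside \<open>Y\<close> lies outside the columns of the rectangle and keeps its
  column, while the rows outside \<open>I\<close> are shifted as a whole.\<close>

definition cell_map :: "int set \<Rightarrow> int \<Rightarrow> (int \<Rightarrow> int) \<Rightarrow> int set \<Rightarrow> int set \<Rightarrow> cell \<Rightarrow> cell" where
  "cell_map I c' f Y K = (\<lambda>(x, y).
     (if y \<in> K then c' else if y \<in> Y \<or> y \<notin> I then f x else x, row_perm Y K y))"

definition ones_map ::
    "int set \<Rightarrow> int \<Rightarrow> int \<Rightarrow> int \<Rightarrow> int \<Rightarrow> (int \<Rightarrow> int) \<Rightarrow> cell set \<Rightarrow> cell set" where
  "ones_map I a b c c' f S =
     (let T = S \<inter> {a..b} \<times> I in cell_map I c' f (snd ` T) (col T c) ` S)"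

text \<open>There are two intended instances: the step itself (\<open>c = a\<close>,
  \<open>c' = b\<close>, shift to the left) and its mirror image (\<open>c = b\<close>,
  \<open>c' = a\<close>, shift to the right). The function \<open>g\<close> undoes the shift
  \<open>f\<close>.\<close>

locale column_move =
  fixes I :: "int set" and a b c c' :: int and f g :: "int \<Rightarrow> int" and S :: "cell set"
  assumes cc: "c \<in> {a..b}" "c' \<in> {a..b}"
    and f_in: "\<And>x. x \<in> {a..b} \<Longrightarrow> x \<noteq> c \<Longrightarrow> f x \<in> {a..b} \<and> f x \<noteq> c'"
    and gf: "\<And>x. g (f x) = x"
    and fin: "finite S" and opr: "one_per_row S"
begin

definition "Y = snd ` (S \<inter> {a..b} \<times> I)"
definition "K = col (S \<inter> {a..b} \<times> I) c"

abbreviation "\<theta> \<equiv> cell_map I c' f Y K"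
abbreviation "S' \<equiv> ones_map I a b c c' f S"

lemma S'_eq: "S' = \<theta> ` S"
  by (simp add: ones_map_def Y_def K_def Let_def)

lemma fin_Y: "finite Y"
  using fin by (simp add: Y_def)

lemma K_sub: "K \<subseteq> Y"
  by (force simp: K_def Y_def col_def)

lemma Y_sub: "Y \<subseteq> I"
  by (auto simp: Y_def)

lemma mem_Y: "(x, y) \<in> S \<Longrightarrow> y \<in> Y \<longleftrightarrow> x \<in> {a..b} \<and> y \<in> I"
  using opr by (force simp: Y_def one_per_row_def)

lemma mem_K: "(x, y) \<in> S \<Longrightarrow> y \<in> K \<longleftrightarrow> x = c \<and> y \<in> I"
  using opr cc by (force simp: K_def col_def one_per_row_def)

lemmas row_perm_facts = row_perm_mem_iff[OF fin_Y K_sub] row_perm_mem_image_iff[OF fin_Y K_sub]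
  row_perm_inverse[OF fin_Y K_sub]

lemma row_perm_in_I: "row_perm Y K y \<in> I \<longleftrightarrow> y \<in> I"
  using row_perm_facts(1)[of y] Y_sub by (auto simp: row_perm_def split: if_splits)

text \<open>Together with \<open>\<theta>_in_col\<close> this locates the 1's of the new rectangle
  and of its new column, from which \<open>Y'_eq\<close> and \<open>K'_eq\<close> compute the data
  of the mirrored map.\<close>

lemma \<theta>_in_rect: "p \<in> S \<Longrightarrow> \<theta> p \<in> {a..b} \<times> I \<longleftrightarrow> snd p \<in> Y"
  using mem_Y[of "fst p" "snd p"] mem_K[of "fst p" "snd p"] f_in[of "fst p"] cc K_sub Y_sub
  by (auto simp: cell_map_def row_perm_in_I split: prod.splits)

lemma \<theta>_in_col: "p \<in> S \<Longrightarrow> snd p \<in> Y \<Longrightarrow> fst (\<theta> p) = c' \<longleftrightarrow> snd p \<in> K"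
  using mem_Y[of "fst p" "snd p"] mem_K[of "fst p" "snd p"] f_in[of "fst p"]
  by (auto simp: cell_map_def split: prod.splits)

lemma snd_\<theta>: "snd (\<theta> p) = row_perm Y K (snd p)"
  by (simp add: cell_map_def split: prod.splits)

lemma S'_rect: "S' \<inter> {a..b} \<times> I = \<theta> ` {p \<in> S. snd p \<in> Y}"
proof -
  have "f ` S \<inter> W = f ` {p \<in> S. f p \<in> W}" for f :: "cell \<Rightarrow> cell" and W by blast
  then show ?thesis unfolding S'_eq by (simp only: \<theta>_in_rect cong: conj_cong)
qed

lemma Y'_eq: "snd ` (S' \<inter> {a..b} \<times> I) = Y"
proof -
  have "snd ` {p \<in> S. snd p \<in> Y} = Y" by (auto simp: Y_def)
  then have "(\<lambda>p. row_perm Y K (snd p)) ` {p \<in> S. snd p \<in> Y} = row_perm Y K ` Y"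
    by (metis (no_types) image_image)
  then show ?thesis
    using row_perm_image[OF fin_Y K_sub order_refl] by (simp add: S'_rect image_image snd_\<theta>)
qed

lemma K'_eq: "col (S' \<inter> {a..b} \<times> I) c' = ord_rev Y ` K"
proof -
  have "col (S' \<inter> {a..b} \<times> I) c' = row_perm Y K ` K"
  proof (intro equalityI subsetI)
    fix z assume "z \<in> col (S' \<inter> {a..b} \<times> I) c'"
    then have "(c', z) \<in> \<theta> ` {p \<in> S. snd p \<in> Y}"
      unfolding S'_rect col_def mem_Collect_eq .
    then obtain p where p: "(c', z) = \<theta> p" "p \<in> {p \<in> S. snd p \<in> Y}" by (rule imageE)
    then have "snd p \<in> K" using \<theta>_in_col[of p] by (metis (no_types) CollectD fst_conv)
    moreover have "z = row_perm Y K (snd p)" using p(1) snd_\<theta>[of p] by (metis snd_conv)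
    ultimately show "z \<in> row_perm Y K ` K" by blast
  next
    fix z assume "z \<in> row_perm Y K ` K"
    then obtain y where y: "y \<in> K" "z = row_perm Y K y" by auto
    then have "(c, y) \<in> S" "y \<in> Y" using K_sub by (auto simp: K_def col_def)
    moreover have "\<theta> (c, y) = (c', z)" using y by (simp add: cell_map_def)
    ultimately show "z \<in> col (S' \<inter> {a..b} \<times> I) c'"
      unfolding S'_rect col_def mem_Collect_eq by (intro rev_image_eqI[of "(c, y)"]) simp_all
  qed
  then show ?thesis by (simp add: row_perm_image_first[OF fin_Y K_sub])
qed

text \<open>The image has the same \<open>Y\<close> and the reversed \<open>K\<close>, so the
  mirrored map uses the inverse row permutation. Each cell falls into the corresponding case again,
  where \<open>g\<close> cancels \<open>f\<close>, or \<open>c\<close> replaces \<open>c'\<close>,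
  or nothing moves.\<close>

lemma ones_map_inverse: "ones_map I a b c' c g S' = S"
proof -
  have *: "cell_map I c g Y (ord_rev Y ` K) (\<theta> p) = p" if "p \<in> S" for p
    using that mem_Y[of "fst p" "snd p"] mem_K[of "fst p" "snd p"] K_sub Y_sub
    by (cases p) (auto simp: cell_map_def row_perm_facts row_perm_in_I gf)
  have "ones_map I a b c' c g S' = cell_map I c g Y (ord_rev Y ` K) ` S'"
    unfolding ones_map_def[of I a b c' c g] Let_def Y'_eq K'_eq ..
  then show ?thesis
    using * by (simp add: S'_eq image_image)
qed

lemma snd_\<theta>_inj:
  assumes "p \<in> S" "q \<in> S" "snd (\<theta> p) = snd (\<theta> q)"
  shows "p = q"
proof -
  have "snd p = snd q"
    using assms(3) injD[OF inj_row_perm[OF fin_Y K_sub]] unfolding snd_\<theta> by blast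
  then show ?thesis
    using assms(1,2) one_per_rowD[OF opr] by (metis prod.collapse)
qed

lemma one_per_row_S': "one_per_row S'"
  unfolding one_per_row_def S'_eq
proof (intro allI impI)
  fix x x' y assume "(x, y) \<in> \<theta> ` S" "(x', y) \<in> \<theta> ` S"
  then obtain p q where "p \<in> S" "q \<in> S" "\<theta> p = (x, y)" "\<theta> q = (x', y)" by force
  moreover from this have "p = q" by (intro snd_\<theta>_inj) simp_all
  ultimately show "x = x'" by simp
qed

text \<open>\<open>Y\<close> is contained in the set of all nonempty rows, so the row permutation
  maps that set onto itself. This preserves the empty rows.\<close>

lemma rows_S': "snd ` S' = snd ` S"
proof -
  have "snd ` S' = row_perm Y K ` snd ` S" by (simp add: S'_eq image_image snd_\<theta>)
  moreover have "Y \<subseteq> snd ` S" by (auto simp: Y_def)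
  ultimately show ?thesis by (simp add: row_perm_image[OF fin_Y K_sub])
qed

end


section \<open>One step of the algorithm\<close>

lemma move_cell_eq:
  "move_cell P (x, y) = (if x = leftmost P then rect_end P
      else if leftmost P < x \<and> x \<le> rect_end P then x - 1 else x, y)"
  by (simp add: move_cell_def)

text \<open>Nonemptiness makes the minimum in \<open>leftmost\<close> an actual column.\<close>

locale nonempty_moon =
  fixes P :: "cell set"
  assumes moon: "moon_polyomino P" and nonempty: "P \<noteq> {}"
begin

definition "a = leftmost P"
definition "I = col P a"
definition "b = rect_end P"
text \<open>The column part of \<open>move_cell\<close>: a cyclic permutation of
  \<open>{a..b}\<close>, extended by the identity to all integers.\<close>

definition "mv x = (if x = a then b else if a < x \<and> x \<le> b then x - 1 else x)"

lemma fin: "finite P"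
  and row_convex: "(x1, y) \<in> P \<Longrightarrow> (x3, y) \<in> P \<Longrightarrow> x1 \<le> x2 \<Longrightarrow> x2 \<le> x3 \<Longrightarrow> (x2, y) \<in> P"
  and col_convex: "(x, y1) \<in> P \<Longrightarrow> (x, y3) \<in> P \<Longrightarrow> y1 \<le> y2 \<Longrightarrow> y2 \<le> y3 \<Longrightarrow> (x, y2) \<in> P"
  using moon unfolding moon_polyomino_def convex_polyomino_def by blast+

lemma comparable:
  "x \<in> col_coords P \<Longrightarrow> x' \<in> col_coords P \<Longrightarrow> col P x \<subseteq> col P x' \<or> col P x' \<subseteq> col P x"
  using moon unfolding moon_polyomino_def intersection_free_def by blast

lemma mem_I: "y \<in> I \<longleftrightarrow> (a, y) \<in> P"
  by (simp add: I_def col_def)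

lemma col_coordsI: "(x, y) \<in> P \<Longrightarrow> x \<in> col_coords P"
  by (force simp: col_coords_def)

lemma a_in: "a \<in> col_coords P"
  using fin nonempty by (simp add: a_def leftmost_def col_coords_def)

lemma a_le: "(x, y) \<in> P \<Longrightarrow> a \<le> x"
  using fin by (auto simp: a_def leftmost_def col_coords_def intro!: Min_le image_eqI)

section \<open>The rows of the leftmost column and the largest rectangle\<close>

lemma I_nonempty: "I \<noteq> {}"
  using a_in by (auto simp: col_coords_def mem_I)

lemma I_convex: "y1 \<in> I \<Longrightarrow> y3 \<in> I \<Longrightarrow> y1 \<le> y2 \<Longrightarrow> y2 \<le> y3 \<Longrightarrow> y2 \<in> I"
  unfolding mem_I by (rule col_convex)

lemma fin_I: "finite I"
proof -
  have "I \<subseteq> snd ` P" by (force simp: mem_I)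
  then show ?thesis using fin finite_subset by blast
qed

text \<open>The bound is the rightmost column that contains all rows of \<open>I\<close>; row
  convexity fills the columns between \<open>a\<close> and it.\<close>

lemma lead_rect_bound:
  obtains \<beta> where "a \<le> \<beta>" "\<And>x y. a \<le> x \<Longrightarrow> x \<le> \<beta> \<Longrightarrow> y \<in> I \<Longrightarrow> (x, y) \<in> P"
    "\<And>x. (\<forall>y\<in>I. (x, y) \<in> P) \<Longrightarrow> x \<le> \<beta>"
proof
  let ?X = "{x. \<forall>y\<in>I. (x, y) \<in> P}"
  obtain y0 where y0: "y0 \<in> I" using I_nonempty by blast
  have "?X \<subseteq> fst ` P" using y0 by force
  then have fX: "finite ?X" using fin finite_subset by blast
  have aX: "a \<in> ?X" by (simp add: mem_I)
  show "a \<le> Max ?X" using fX aX by (rule Max_ge)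
  show "x \<le> Max ?X" if "\<forall>y\<in>I. (x, y) \<in> P" for x using fX that by (intro Max_ge) auto
  show "(x, y) \<in> P" if "a \<le> x" "x \<le> Max ?X" "y \<in> I" for x y
  proof -
    have "Max ?X \<in> ?X" using Max_in[OF fX] aX by auto
    then have "(Max ?X, y) \<in> P" using that by simp
    moreover have "(a, y) \<in> P" using that mem_I by simp
    ultimately show ?thesis using that row_convex by blast
  qed
qed

text \<open>A competing rectangle contains the leftmost column, hence all rows of \<open>I\<close>,
  and no other row, since column \<open>a\<close> would have to contain it. Each of its columns then
  contains \<open>I\<close>, so it respects the bound.\<close>

lemma lead_rect_eqI:
  assumes "a \<le> \<beta>" "\<And>x y. a \<le> x \<Longrightarrow> x \<le> \<beta> \<Longrightarrow> y \<in> I \<Longrightarrow> (x, y) \<in> P"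
    "\<And>x. (\<forall>y\<in>I. (x, y) \<in> P) \<Longrightarrow> x \<le> \<beta>"
  shows "lead_rect P = {a..\<beta>} \<times> I"
  unfolding lead_rect_def a_def[symmetric] I_def[symmetric]
proof (rule Greatest_equality)
  \<comment> \<open>Column convexity makes \<open>I\<close> an interval, as
    \<open>is_rectangle\<close> demands.\<close>
  have "I = {Min I..Max I}"
  proof (intro equalityI subsetI)
    fix y assume "y \<in> {Min I..Max I}"
    then show "y \<in> I"
      using I_convex[OF Min_in[OF fin_I I_nonempty] Max_in[OF fin_I I_nonempty]] by simp
  qed (use fin_I in simp)
  then have "is_rectangle ({a..\<beta>} \<times> I)" unfolding is_rectangle_def by metis
  then show "is_rectangle ({a..\<beta>} \<times> I) \<and> {a..\<beta>} \<times> I \<subseteq> P \<and> {a} \<times> I \<subseteq> {a..\<beta>} \<times> I"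
    using assms by auto
next
  fix R assume R: "is_rectangle R \<and> R \<subseteq> P \<and> {a} \<times> I \<subseteq> R"
  then obtain x1 x2 y1 y2 where R_eq: "R = {x1..x2} \<times> {y1..y2}"
    unfolding is_rectangle_def by blast
  show "R \<subseteq> {a..\<beta>} \<times> I"
  proof
    fix p assume "p \<in> R"
    then obtain x y where p: "p = (x, y)" "x \<in> {x1..x2}" "y \<in> {y1..y2}" using R_eq by auto
    have I_sub: "I \<subseteq> {y1..y2}" and "a \<in> {x1..x2}" using R R_eq I_nonempty by blast+
    then have "(a, y) \<in> P" using R R_eq p by auto
    moreover have "\<forall>y\<in>I. (x, y) \<in> P" using R R_eq p I_sub by auto
    moreover have "a \<le> x" using R \<open>p \<in> R\<close> p a_le by auto
    ultimately show "p \<in> {a..\<beta>} \<times> I" using assms(3) p mem_I by auto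
  qed
qed

lemma lead_rect_eq: "lead_rect P = {a..b} \<times> I"
  and a_le_b: "a \<le> b"
  and rect_sub: "a \<le> x \<Longrightarrow> x \<le> b \<Longrightarrow> y \<in> I \<Longrightarrow> (x, y) \<in> P"
  and le_b: "(\<And>y. y \<in> I \<Longrightarrow> (x, y) \<in> P) \<Longrightarrow> x \<le> b"
proof -
  obtain \<beta> where \<beta>: "a \<le> \<beta>" "\<And>x y. a \<le> x \<Longrightarrow> x \<le> \<beta> \<Longrightarrow> y \<in> I \<Longrightarrow> (x, y) \<in> P"
    "\<And>x. (\<forall>y\<in>I. (x, y) \<in> P) \<Longrightarrow> x \<le> \<beta>"
    by (rule lead_rect_bound) blast
  have eq: "lead_rect P = {a..\<beta>} \<times> I" using \<beta> by (rule lead_rect_eqI) auto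
  have "col_coords (lead_rect P) = {a..\<beta>}"
    unfolding eq col_coords_def using I_nonempty by simp
  moreover have "Max {a..\<beta>} = \<beta>" using \<beta>(1) by (intro Max_eqI) auto
  ultimately have "b = \<beta>" by (simp add: b_def rect_end_def)
  then show "lead_rect P = {a..b} \<times> I" "a \<le> b" "a \<le> x \<Longrightarrow> x \<le> b \<Longrightarrow> y \<in> I \<Longrightarrow> (x, y) \<in> P"
    "(\<And>y. y \<in> I \<Longrightarrow> (x, y) \<in> P) \<Longrightarrow> x \<le> b"
    using eq \<beta> by auto
qed

text \<open>A column with a row outside \<open>I\<close> is comparable with column \<open>a\<close>,
  so it properly contains it and belongs to the columns of the rectangle.\<close>

lemma off_I: "(x, y) \<in> P \<Longrightarrow> y \<notin> I \<Longrightarrow> a < x \<and> x \<le> b"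
  using a_le[of x y] comparable[OF col_coordsI a_in, of x y] le_b[of x]
  by (auto simp: I_def col_def order_le_less subset_iff)

section \<open>The polyomino after one step\<close>

lemma move_cell_mv: "move_cell P (x, y) = (mv x, y)"
  by (simp add: move_cell_eq mv_def a_def b_def)

lemma inj_mv: "mv x = mv x' \<longleftrightarrow> x = x'"
  using a_le_b by (auto simp: mv_def)

lemma mem_alpha_mv: "(mv x, y) \<in> alpha_step P \<longleftrightarrow> (x, y) \<in> P"
  by (force simp: alpha_step_def move_cell_mv inj_mv)

lemma ex_mv: "\<exists>x'. x = mv x'"
proof -
  consider "x = b" | "a \<le> x" "x < b" | "x < a" | "x > b" using a_le_b by linarith
  then show ?thesis
  proof cases
    case 1 then show ?thesis by (intro exI[of _ a]) (simp add: mv_def)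
  next
    case 2 then show ?thesis by (intro exI[of _ "x + 1"]) (simp add: mv_def)
  next
    case 3 then show ?thesis by (intro exI[of _ x]) (simp add: mv_def)
  next
    case 4 then show ?thesis using a_le_b by (intro exI[of _ x]) (simp add: mv_def)
  qed
qed

text \<open>A second view of the step, row by row instead of column by column. A row of
  \<open>I\<close> contains all of \<open>{a..b}\<close>, which \<open>mv\<close> only permutes; any
  other row lies in \<open>{a+1..b}\<close> by \<open>off_I\<close> and is shifted by one.\<close>

lemma mem_alpha: "(x, y) \<in> alpha_step P \<longleftrightarrow> (if y \<in> I then (x, y) \<in> P else (x + 1, y) \<in> P)"
proof -
  obtain x' where x': "x = mv x'" using ex_mv by blast
  have "(x', y) \<in> P \<longleftrightarrow> (if y \<in> I then (mv x', y) \<in> P else (mv x' + 1, y) \<in> P)"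
  proof (cases "y \<in> I")
    case True
    show ?thesis
    proof (cases "a \<le> x' \<and> x' \<le> b")
      case 2: True
      then have "a \<le> mv x' \<and> mv x' \<le> b" by (auto simp: mv_def)
      then show ?thesis using True 2 rect_sub by simp
    next
      case False
      then have "mv x' = x'" using a_le_b by (auto simp: mv_def)
      then show ?thesis using True by simp
    qed
  next
    case False
    consider "x' = a" | "a < x'" "x' \<le> b" | "x' < a \<or> x' > b" by linarith
    then show ?thesis
    proof cases
      \<comment> \<open>The first column goes to \<open>b\<close>, and a row outside
        \<open>I\<close> has no cell at \<open>b + 1\<close>.\<close>
      case 1 then show ?thesis using False off_I[of "b + 1" y] by (auto simp: mv_def mem_I)
    next
      case 2 then show ?thesis using False by (simp add: mv_def)
    next
      case 3
      then have "mv x' = x'" using a_le_b by (auto simp: mv_def)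
      then show ?thesis using 3 False off_I[of x' y] off_I[of "x' + 1" y] by auto
    qed
  qed
  then show ?thesis by (simp add: x' mem_alpha_mv)
qed

lemma alpha_image: "alpha_step P = (\<lambda>(x, y). (if y \<in> I then x else x - 1, y)) ` P"
  by (rule set_eqI) (force simp: mem_alpha split: if_splits prod.splits)

lemma fin_alpha: "finite (alpha_step P)"
  using fin by (simp add: alpha_step_def)

lemma col_alpha_mv: "col (alpha_step P) (mv x) = col P x"
  by (simp add: col_def mem_alpha_mv)

lemma col_coords_iff: "x \<in> col_coords Q \<longleftrightarrow> col Q x \<noteq> {}"
  by (force simp: col_coords_def col_def)

lemma col_coords_interval: "a \<le> x \<Longrightarrow> x \<le> b \<Longrightarrow> x \<in> col_coords P"
  using rect_sub[of x] I_nonempty by (auto simp: col_coords_iff col_def)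

lemma col_coords_mv: "mv x \<in> col_coords P \<longleftrightarrow> x \<in> col_coords P"
  using col_coords_interval a_le_b by (auto simp: mv_def)

lemma col_coords_alpha: "col_coords (alpha_step P) = col_coords P"
proof (rule set_eqI)
  fix x
  obtain x' where "x = mv x'" using ex_mv by blast
  then show "x \<in> col_coords (alpha_step P) \<longleftrightarrow> x \<in> col_coords P"
    using col_coords_mv[of x'] by (simp add: col_coords_iff col_alpha_mv)
qed

lemma leftmost_alpha: "leftmost (alpha_step P) = a"
  by (simp add: leftmost_def col_coords_alpha a_def)

lemma row_coords_alpha: "row_coords (alpha_step P) = row_coords P"
  by (simp add: row_coords_def alpha_image image_image case_prod_unfold)

text \<open>Row convexity is read off the row view \<open>mem_alpha\<close>; column convexity and
  comparability are read off the column view, in which the columns are only permuted.\<close>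

lemma moon_alpha: "moon_polyomino (alpha_step P)"
  unfolding moon_polyomino_def convex_polyomino_def intersection_free_def
proof (intro conjI allI impI ballI)
  show "finite (alpha_step P)" by (rule fin_alpha)
  show "(x2, y) \<in> alpha_step P"
    if "(x1, y) \<in> alpha_step P \<and> (x3, y) \<in> alpha_step P \<and> x1 \<le> x2 \<and> x2 \<le> x3" for y x1 x2 x3
    using that row_convex[of x1 y x3 x2] row_convex[of "x1 + 1" y "x3 + 1" "x2 + 1"]
    by (auto simp: mem_alpha split: if_splits)
  show "(x, y2) \<in> alpha_step P"
    if "(x, y1) \<in> alpha_step P \<and> (x, y3) \<in> alpha_step P \<and> y1 \<le> y2 \<and> y2 \<le> y3" for x y1 y2 y3
  proof -
    obtain x' where "x = mv x'" using ex_mv by blast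
    then show ?thesis using that col_convex[of x' y1 y3 y2] by (simp add: mem_alpha_mv)
  qed
  show "col (alpha_step P) x \<subseteq> col (alpha_step P) x' \<or> col (alpha_step P) x' \<subseteq> col (alpha_step P) x"
    if "x \<in> col_coords (alpha_step P)" "x' \<in> col_coords (alpha_step P)" for x x'
  proof -
    obtain z z' where "x = mv z" "x' = mv z'" using ex_mv by meson
    then show ?thesis
      using that comparable[of z z'] by (simp add: col_alpha_mv col_coords_alpha col_coords_mv)
  qed
qed

text \<open>The measure that ends the algorithm. The leftmost coordinate stays \<open>a\<close>,
  rows of \<open>I\<close> contribute the same as before, and a polyomino that is not left-aligned
  has a row outside \<open>I\<close>, whose cells lie strictly right of \<open>a\<close> and come
  closer by one.\<close>

lemma sum_offset_alpha:
  assumes "\<not> left_aligned P"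
  shows "(\<Sum>p\<in>alpha_step P. nat (fst p - leftmost (alpha_step P))) < (\<Sum>p\<in>P. nat (fst p - leftmost P))"
proof -
  let ?h = "\<lambda>(x, y). (if y \<in> I then x else x - 1, y)"
  have "inj_on ?h P" by (auto simp: inj_on_def split: if_splits)
  then have "(\<Sum>p\<in>alpha_step P. nat (fst p - leftmost (alpha_step P))) = (\<Sum>p\<in>P. nat (fst (?h p) - a))"
    by (simp only: alpha_image[symmetric] leftmost_alpha sum.reindex o_def
        sum.reindex[of ?h P "\<lambda>p. nat (fst p - a)", folded alpha_image])
  also have "\<dots> < (\<Sum>p\<in>P. nat (fst p - a))"
  proof (rule sum_strict_mono_ex1[OF fin])
    show "\<forall>p\<in>P. nat (fst (?h p) - a) \<le> nat (fst p - a)" by auto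
    obtain x y where "(x, y) \<in> P" "(a, y) \<notin> P"
      using assms by (auto simp: left_aligned_def row_coords_def a_def)
    then show "\<exists>p\<in>P. nat (fst (?h p) - a) < nat (fst p - a)"
      using off_I[of x y] by (intro bexI[of _ "(x, y)"]) (auto simp: mem_I)
  qed
  finally show ?thesis by (simp add: a_def)
qed

text \<open>Two opposite corners being given, the other two suffice: column convexity yields the two
  vertical sides, and row convexity then yields the interior.\<close>

lemma rectangle_subset_iff:
  assumes "(x1, y1) \<in> P" "(x2, y2) \<in> P" "x1 \<le> x2" "y1 \<le> y2"
  shows "{x1..x2} \<times> {y1..y2} \<subseteq> P \<longleftrightarrow> (x1, y2) \<in> P \<and> (x2, y1) \<in> P"
proof
  assume "(x1, y2) \<in> P \<and> (x2, y1) \<in> P"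
  then have "(x1, y) \<in> P" "(x2, y) \<in> P" if "y1 \<le> y" "y \<le> y2" for y
    using that assms col_convex by blast+
  then show "{x1..x2} \<times> {y1..y2} \<subseteq> P" using row_convex by clarsimp meson
qed (use assms in auto)

end


section \<open>Preservation of the chains\<close>

text \<open>Copying the unshaded row of index \<open>j\<close> to the unshaded row of index
  \<open>j\<close> is the order isomorphism between the two sets of rows, and the new last column is
  the reversal of \<open>K\<close>.\<close>

lemma (in column_move) new_rect_ones_eq:
  assumes "c = a" "c' = b" "f = (\<lambda>x. x - 1)"
  shows "new_rect_ones a b (S \<inter> {a..b} \<times> I) = \<theta> ` (S \<inter> {a..b} \<times> I)"
proof -
  let ?T = "S \<inter> {a..b} \<times> I"
  let ?U = "sorted_list_of_set (Y - K)" and ?U' = "sorted_list_of_set (Y - ord_rev Y ` K)"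
  have Y_eq: "row_coords ?T = Y" by (simp add: Y_def row_coords_def)
  have K_eq: "col ?T a = K" unfolding K_def by (simp only: assms(1))
  have fin_D: "finite (Y - K)" using fin_Y by simp
  have \<theta>_K: "\<theta> (a, y) = (b, ord_rev Y y)" if "y \<in> K" for y
    using that K_sub by (auto simp: cell_map_def row_perm_def assms)
  have \<theta>_U: "\<theta> (x, ?U ! j) = (x - 1, ?U' ! j)" if "j < length ?U" for x j
  proof -
    have "?U ! j \<in> Y - K" using that fin_D nth_sorted_in[of "Y - K" j] by simp
    moreover have "ord_iso (Y - K) (Y - ord_rev Y ` K) (?U ! j) = ?U' ! j"
      using that fin_D ord_iso_nth[of "Y - K" j] by simp
    ultimately show ?thesis by (simp add: cell_map_def row_perm_def assms)
  qed
  have new: "new_rect_ones a b ?T = {b} \<times> ord_rev Y ` K \<union>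
      {(x - 1, ?U' ! j) | x j. a < x \<and> x \<le> b \<and> j < length ?U \<and> (x, ?U ! j) \<in> ?T}"
    by (simp only: new_rect_ones_def Let_def Y_eq K_eq new_last_column_eq[OF fin_Y K_sub])
  have in_T: "(x, y) \<in> ?T \<Longrightarrow> y \<in> Y \<and> (y \<in> K \<longleftrightarrow> x = a) \<and> a \<le> x \<and> x \<le> b" for x y
    using mem_Y[of x y] mem_K[of x y] assms by auto
  have K_T: "y \<in> K \<Longrightarrow> (a, y) \<in> ?T" for y unfolding K_eq[symmetric] col_def by simp
  show ?thesis unfolding new
  proof (intro equalityI subsetI)
    fix p assume "p \<in> {b} \<times> ord_rev Y ` K \<union>
      {(x - 1, ?U' ! j) | x j. a < x \<and> x \<le> b \<and> j < length ?U \<and> (x, ?U ! j) \<in> ?T}"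
    then consider y where "p = (b, ord_rev Y y)" "y \<in> K"
      | x j where "p = (x - 1, ?U' ! j)" "j < length ?U" "(x, ?U ! j) \<in> ?T" by auto
    then show "p \<in> \<theta> ` ?T"
      by cases (metis K_T \<theta>_K imageI, metis \<theta>_U imageI)
  next
    fix p assume "p \<in> \<theta> ` ?T"
    then obtain x y where p: "p = \<theta> (x, y)" "(x, y) \<in> ?T" by (elim imageE) auto
    show "p \<in> {b} \<times> ord_rev Y ` K \<union>
      {(x - 1, ?U' ! j) | x j. a < x \<and> x \<le> b \<and> j < length ?U \<and> (x, ?U ! j) \<in> ?T}"
    proof (cases "y \<in> K")
      case True
      then show ?thesis using p in_T[OF p(2)] \<theta>_K by auto
    next
      case False
      then have "y \<in> Y - K" "a < x" "x \<le> b" using in_T[OF p(2)] by auto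
      moreover from this obtain j where "j < length ?U" "y = ?U ! j"
        using ex_nth_sorted[OF fin_D] by (metis length_sorted_list_of_set)
      ultimately show ?thesis using p \<theta>_U by blast
    qed
  qed
qed

text \<open>The rectangle condition is replaced by its two missing corners, because the membership
  of single cells can be followed through the step.\<close>

definition chains :: "cell set \<Rightarrow> cell set \<Rightarrow> (cell \<times> cell) set" where
  "chains P S = {(p, q). p \<in> S \<and> q \<in> S \<and> fst p < fst q \<and> snd p < snd q \<and>
     (fst p, snd q) \<in> P \<and> (fst q, snd p) \<in> P}"

context nonempty_moon
begin

lemma ne_chains_eq: "ne_chains P F = chains P (one_cells P F)"
proof (intro equalityI subsetI)
  fix w assume "w \<in> ne_chains P F"
  then obtain x1 y1 x2 y2 where w: "w = ((x1, y1), (x2, y2))" "(x1, y1) \<in> one_cells P F"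
    "(x2, y2) \<in> one_cells P F" "x1 < x2" "y1 < y2" "{x1..x2} \<times> {y1..y2} \<subseteq> P"
    unfolding ne_chains_def by blast
  then have "(x1, y2) \<in> P" "(x2, y1) \<in> P" by auto
  then show "w \<in> chains P (one_cells P F)" using w by (simp add: chains_def)
next
  fix w assume "w \<in> chains P (one_cells P F)"
  then obtain x1 y1 x2 y2 where w: "w = ((x1, y1), (x2, y2))" "(x1, y1) \<in> one_cells P F"
    "(x2, y2) \<in> one_cells P F" "x1 < x2" "y1 < y2" "(x1, y2) \<in> P" "(x2, y1) \<in> P"
    unfolding chains_def by auto
  then have "{x1..x2} \<times> {y1..y2} \<subseteq> P"
    using rectangle_subset_iff[of x1 y1 x2 y2] by (simp add: one_cells_def)
  then show "w \<in> ne_chains P F" using w unfolding ne_chains_def by blast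
qed

lemma nonempty_moon_alpha: "nonempty_moon (alpha_step P)"
  using moon_alpha nonempty by unfold_locales (simp_all add: alpha_step_def)

abbreviation "ones_step \<equiv> ones_map I a b a b (\<lambda>x. x - 1)"
abbreviation "ones_back \<equiv> ones_map I a b b a (\<lambda>x. x + 1)"

lemma column_move_fw:
  "S \<subseteq> P \<Longrightarrow> one_per_row S \<Longrightarrow> column_move a b a b (\<lambda>x. x - 1) (\<lambda>x. x + 1) S"
  using a_le_b fin by unfold_locales (auto intro: finite_subset)

lemma column_move_bw:
  "S \<subseteq> alpha_step P \<Longrightarrow> one_per_row S \<Longrightarrow> column_move a b b a (\<lambda>x. x + 1) (\<lambda>x. x - 1) S"
  using a_le_b fin_alpha by unfold_locales (auto intro: finite_subset)

section \<open>The step on a set of 1-cells\<close>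

context
  fixes S
  assumes S: "S \<subseteq> P" "one_per_row S"
begin

interpretation fw: column_move I a b a b "\<lambda>x. x - 1" "\<lambda>x. x + 1" S
  by (rule column_move_fw[OF S])

abbreviation (input) "rp \<equiv> row_perm fw.Y fw.K"

text \<open>The possible positions of a 1-cell: first column, rest of the rectangle, row outside
  \<open>I\<close>, right of the rectangle. \<open>off_I\<close> and \<open>a_le\<close> exclude all
  others.\<close>

lemma cases_S:
  assumes "(x, y) \<in> S"
  obtains "x = a" "y \<in> I" "y \<in> fw.Y" "y \<in> fw.K"
  | "a < x" "x \<le> b" "y \<in> I" "y \<in> fw.Y" "y \<notin> fw.K"
  | "a < x" "x \<le> b" "y \<notin> I" "y \<notin> fw.Y" "y \<notin> fw.K"
  | "b < x" "y \<in> I" "y \<notin> fw.Y" "y \<notin> fw.K"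
proof -
  have P: "(x, y) \<in> P" using assms S by blast
  show thesis
    using fw.mem_Y[OF assms] fw.mem_K[OF assms] off_I[OF P] a_le[OF P] a_le_b P that mem_I
    by (cases "x = a"; cases "y \<in> I"; cases "x \<le> b") auto
qed

text \<open>Although \<open>cell_map\<close> selects its case by the row, on 1-cells the new column
  depends on the old column only. The step thus acts on the two coordinates separately.\<close>

lemma \<theta>_eq: "(x, y) \<in> S \<Longrightarrow> fw.\<theta> (x, y) = (mv x, rp y)"
  by (erule cases_S) (use a_le_b in \<open>auto simp: cell_map_def mv_def\<close>)

lemma ones_step_image: "ones_step S = (\<lambda>(x, y). (mv x, rp y)) ` S"
  unfolding fw.S'_eq by (intro image_cong refl) (auto simp: \<theta>_eq)

text \<open>The left side is the set that \<open>g_step\<close> fills in. A 1 outside the rectangle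
  has its row outside \<open>Y\<close>, so \<open>row_perm\<close> fixes this row and only
  \<open>mv\<close> acts.\<close>

lemma ones_step_move:
  "move_cell P ` (S - lead_rect P) \<union> new_rect_ones a b (S \<inter> lead_rect P) = ones_step S"
proof -
  have "move_cell P p = fw.\<theta> p" if p_S: "p \<in> S - {a..b} \<times> I" for p
  proof -
    obtain x y where p: "p = (x, y)" "(x, y) \<in> S" using p_S by (metis DiffD1 surj_pair)
    then have "y \<notin> fw.Y" using p_S fw.mem_Y[of x y] by auto
    then show ?thesis using p by (simp add: move_cell_mv \<theta>_eq row_perm_def)
  qed
  then have "move_cell P ` (S - {a..b} \<times> I) = fw.\<theta> ` (S - {a..b} \<times> I)"
    by (rule image_cong[OF refl])
  then have "move_cell P ` (S - {a..b} \<times> I) \<union> fw.\<theta> ` (S \<inter> {a..b} \<times> I) = fw.\<theta> ` S"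
    by (metis Un_Diff_Int image_Un)
  then show ?thesis
    by (simp add: lead_rect_eq fw.new_rect_ones_eq fw.S'_eq)
qed

lemma rp_mem_P: "(x, y) \<in> S \<Longrightarrow> (x, rp y) \<in> P"
proof (cases "y \<in> fw.Y")
  case True
  assume xy: "(x, y) \<in> S"
  then have "a \<le> x" "x \<le> b" "rp y \<in> I" using True by (auto simp: fw.mem_Y fw.row_perm_in_I)
  then show ?thesis by (rule rect_sub)
next
  case False
  assume "(x, y) \<in> S"
  then show ?thesis using False S by (auto simp: row_perm_def)
qed

lemma ones_step_subset: "ones_step S \<subseteq> alpha_step P"
  unfolding ones_step_image by (auto simp: mem_alpha_mv rp_mem_P)

lemma card_col_ones_step: "card (col (ones_step S) (mv x)) = card (col S x)"
proof -
  have "col (ones_step S) (mv x) = rp ` col S x"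
    by (auto simp: ones_step_image col_def inj_mv)
  then show ?thesis
    by (metis card_image inj_on_subset inj_row_perm[OF fw.fin_Y fw.K_sub] subset_UNIV)
qed

lemma one_per_row_step: "one_per_row (ones_step S)"
  by (rule fw.one_per_row_S')

lemma rows_step: "snd ` ones_step S = snd ` S"
  by (rule fw.rows_S')

lemma back_step: "ones_back (ones_step S) = S"
  by (rule fw.ones_map_inverse)

lemma finite_S: "finite S"
  by (rule fw.fin)

text \<open>The chains after the step, pulled back to pairs of old 1-cells, so that old and new
  chains are subsets of the same product.\<close>

definition "moved_chains = {(p, q). p \<in> S \<and> q \<in> S \<and> mv (fst p) < mv (fst q) \<and>
   rp (snd p) < rp (snd q) \<and> (fst p, rp (snd q)) \<in> P \<and> (fst q, rp (snd p)) \<in> P}"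

lemma card_chains_step: "card (chains (alpha_step P) (ones_step S)) = card moved_chains"
proof -
  let ?h = "\<lambda>(x, y). (mv x, rp y)"
  have inj: "inj_on ?h S"
    using inj_mv injD[OF inj_row_perm[OF fw.fin_Y fw.K_sub]] by (auto simp: inj_on_def)
  have "chains (alpha_step P) (ones_step S) = map_prod ?h ?h ` moved_chains"
  proof (intro equalityI subsetI)
    fix w assume "w \<in> chains (alpha_step P) (ones_step S)"
    then obtain x1 y1 x2 y2 where w: "w = (?h (x1, y1), ?h (x2, y2))" "(x1, y1) \<in> S" "(x2, y2) \<in> S"
      "mv x1 < mv x2" "rp y1 < rp y2" "(x1, rp y2) \<in> P" "(x2, rp y1) \<in> P"
      unfolding chains_def ones_step_image by (auto simp: mem_alpha_mv)
    then show "w \<in> map_prod ?h ?h ` moved_chains"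
      by (intro image_eqI[of _ _ "((x1, y1), (x2, y2))"]) (auto simp: moved_chains_def)
  next
    fix w assume "w \<in> map_prod ?h ?h ` moved_chains"
    then show "w \<in> chains (alpha_step P) (ones_step S)"
      unfolding moved_chains_def chains_def ones_step_image by (auto simp: mem_alpha_mv)
  qed
  moreover have "inj_on (map_prod ?h ?h) moved_chains"
    by (rule inj_on_subset[OF map_prod_inj_on[OF inj inj]]) (auto simp: moved_chains_def)
  ultimately show ?thesis by (simp add: card_image)
qed

section \<open>Comparison of old and new chains in three classes\<close>

lemma same_row: "(x, y) \<in> S \<Longrightarrow> (x', y) \<in> S \<Longrightarrow> x = x'"
  by (rule one_per_rowD[OF S(2)])

lemma Y_cell: "y \<in> fw.Y \<Longrightarrow> \<exists>x. (x, y) \<in> S \<and> a \<le> x \<and> x \<le> b"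
  by (auto simp: fw.Y_def)

lemma K_cell: "y \<in> fw.K \<Longrightarrow> (a, y) \<in> S"
  by (auto simp: fw.K_def col_def)

lemma rp_fix: "y \<notin> fw.Y \<Longrightarrow> rp y = y"
  by (simp add: row_perm_def)

text \<open>Such a \<open>q\<close> is fixed by the step, and whether \<open>p\<close> forms a chain
  with it depends only on the row of \<open>p\<close>, since the rectangle supplies the corner in
  the row of \<open>q\<close>. The rows of \<open>Y\<close> are merely permuted, so the numbers
  agree.\<close>

lemma chains_outer:
  "card {(p, q) \<in> chains P S. snd p \<in> fw.Y \<and> snd q \<in> I \<and> b < fst q} =
   card {(p, q) \<in> moved_chains. snd p \<in> fw.Y \<and> snd q \<in> I \<and> b < fst q}"
    (is "card ?C = card ?C'")
proof -
  let ?Z = "{(y, q). y \<in> fw.Y \<and> q \<in> S \<and> snd q \<in> I \<and> b < fst q \<and> y < snd q \<and> (fst q, y) \<in> P}"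
  have q: "rp y = y" "mv x = x" if "(x, y) \<in> S" "b < x" for x y
    using that fw.mem_Y[of x y] a_le_b by (auto simp: rp_fix mv_def)
  have mv_le: "mv x \<le> b" if "a \<le> x" "x \<le> b" for x
    using that by (auto simp: mv_def)
  have 1: "bij_betw (\<lambda>(p, q). (snd p, q)) ?C ?Z"
    unfolding bij_betw_def
  proof
    show "inj_on (\<lambda>(p, q). (snd p, q)) ?C"
      using same_row by (auto simp: inj_on_def chains_def)
    show "(\<lambda>(p, q). (snd p, q)) ` ?C = ?Z"
    proof (intro equalityI subsetI)
      fix w assume "w \<in> ?Z"
      then obtain x y q where w: "w = (y, q)" "(x, y) \<in> S" "a \<le> x" "x \<le> b" "(y, q) \<in> ?Z"
        using Y_cell by blast
      then have "((x, y), q) \<in> ?C" using rect_sub by (auto simp: chains_def)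
      then show "w \<in> (\<lambda>(p, q). (snd p, q)) ` ?C" using w(1) by force
    qed (auto simp: chains_def)
  qed
  \<comment> \<open>The row recorded is now the new row of \<open>p\<close>. All of \<open>Y\<close>
    is reached because \<open>rp\<close> permutes \<open>Y\<close>.\<close>
  have 2: "bij_betw (\<lambda>(p, q). (rp (snd p), q)) ?C' ?Z"
    unfolding bij_betw_def
  proof
    show "inj_on (\<lambda>(p, q). (rp (snd p), q)) ?C'"
    proof (rule inj_onI)
      fix v w assume v: "v \<in> ?C'" and w: "w \<in> ?C'"
        and eq: "(\<lambda>(p, q). (rp (snd p), q)) v = (\<lambda>(p, q). (rp (snd p), q)) w"
      obtain p q p' q' where e: "v = (p, q)" "w = (p', q')" by (metis surj_pair)
      have "snd p = snd p'" "q = q'"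
        using eq e injD[OF inj_row_perm[OF fw.fin_Y fw.K_sub]] by auto
      moreover have "p \<in> S" "p' \<in> S" using e v w by (auto simp: moved_chains_def)
      ultimately show "v = w" using e same_row by (metis prod.collapse)
    qed
    show "(\<lambda>(p, q). (rp (snd p), q)) ` ?C' = ?Z"
    proof (intro equalityI subsetI)
      fix w assume "w \<in> ?Z"
      then obtain y q where w: "w = (y, q)" "(y, q) \<in> ?Z" by blast
      then have "y \<in> rp ` fw.Y" using row_perm_image[OF fw.fin_Y fw.K_sub order_refl] by simp
      then obtain z x where z: "y = rp z" "z \<in> fw.Y" "(x, z) \<in> S" "a \<le> x" "x \<le> b"
        using Y_cell by blast
      then have "((x, z), q) \<in> ?C'"
        using w(2) rect_sub[of x "snd q"] mv_le[of x] q[of "fst q" "snd q"]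
        by (simp add: moved_chains_def)
      then show "w \<in> (\<lambda>(p, q). (rp (snd p), q)) ` ?C'" using w(1) z(1) by force
    qed (auto simp: moved_chains_def q fw.row_perm_facts)
  qed
  show ?thesis
    by (rule trans[OF bij_betw_same_card[OF 1] sym[OF bij_betw_same_card[OF 2]]])
qed

text \<open>Both sides are counted by the pairs of rows \<open>(y, z)\<close> with \<open>y \<in> K\<close>, \<open>z \<in> Y - K\<close> and
  \<open>y < z\<close>: reversing the order of \<open>Y\<close> turns the white cells below a 1 of the new last column
  into white cells above a 1 of the old first column.\<close>

lemma chains_first:
  "card {(p, q) \<in> chains P S. \<not> (snd p \<in> fw.Y \<and> snd q \<in> I \<and> b < fst q) \<and> (fst p = a \<or> fst q = a)} =
   card {(p, q) \<in> moved_chains. \<not> (snd p \<in> fw.Y \<and> snd q \<in> I \<and> b < fst q) \<and> (fst p = a \<or> fst q = a)}"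
    (is "card ?C = card ?C'")
proof -
  let ?Z = "{(y, z). y \<in> fw.K \<and> z \<in> fw.Y - fw.K \<and> y < z}"
  let ?r = "ord_rev fw.Y"
  let ?pr = "row_perm fw.Y (?r ` fw.K)"
  note rev = ord_rev_in[OF fw.fin_Y] ord_rev_inverse[OF fw.fin_Y]
    ord_rev_less_iff[OF fw.fin_Y] ord_rev_mem_image_iff[OF fw.fin_Y fw.K_sub]
  have K_Y: "y \<in> fw.K \<Longrightarrow> y \<in> fw.Y" for y using fw.K_sub by blast
  have rp_K: "rp y = ?r y" if "y \<in> fw.K" for y using that K_Y by (simp add: row_perm_def)
  \<comment> \<open>Before the step the first column can only supply the left cell \<open>p\<close>.
    The corner \<open>(a, snd q)\<close> puts the row of \<open>q\<close> into \<open>I\<close>, and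
    excluding the first class keeps \<open>q\<close> in the rectangle.\<close>
  have C_D: "snd p \<in> fw.K \<and> snd q \<in> fw.Y - fw.K \<and> snd p < snd q" if pq: "(p, q) \<in> ?C" for p q
  proof -
    obtain x1 y1 x2 y2 where e: "p = (x1, y1)" "q = (x2, y2)" by (metis surj_pair)
    have h: "(x1, y1) \<in> S" "(x2, y2) \<in> S" "x1 < x2" "y1 < y2" "(x1, y2) \<in> P"
      "\<not> (y1 \<in> fw.Y \<and> y2 \<in> I \<and> b < x2)" "x1 = a \<or> x2 = a"
      using pq e by (auto simp: chains_def)
    have "x1 = a" using h a_le[of x1 y1] S(1) by auto
    then have "y2 \<in> I" using h mem_I by simp
    then show ?thesis
      using h \<open>x1 = a\<close> e a_le_b by (auto elim!: cases_S)
  qed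
  \<comment> \<open>After the step the moved column is at \<open>b\<close>, so it supplies the right
    cell \<open>q\<close>: a cell to the right of the moved column would give a pair of the first
    class.\<close>
  have C'_D: "snd q \<in> fw.K \<and> snd p \<in> fw.Y - fw.K \<and> rp (snd p) < rp (snd q)"
    if pq: "(p, q) \<in> ?C'" for p q
  proof -
    obtain x1 y1 x2 y2 where e: "p = (x1, y1)" "q = (x2, y2)" by (metis surj_pair)
    have h: "(x1, y1) \<in> S" "(x2, y2) \<in> S" "mv x1 < mv x2" "rp y1 < rp y2" "(x1, rp y2) \<in> P"
      "(x2, rp y1) \<in> P" "\<not> (y1 \<in> fw.Y \<and> y2 \<in> I \<and> b < x2)" "x1 = a \<or> x2 = a"
      using pq e by (auto simp: moved_chains_def)
    have "x1 \<noteq> a"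
    proof
      assume x1: "x1 = a"
      then have "b < x2" using h(3) a_le_b by (auto simp: mv_def split: if_splits)
      moreover have "y1 \<in> fw.Y" using h(1) x1 a_le_b by (auto elim!: cases_S)
      moreover have "y2 \<in> I" using h(2) \<open>b < x2\<close> by (auto elim!: cases_S)
      ultimately show False using h(7) by blast
    qed
    then have x2: "x2 = a" using h by blast
    then have "y1 \<in> I" using h(6) mem_I fw.row_perm_in_I by blast
    moreover have "x1 \<le> b" using h(3) x2 by (auto simp: mv_def split: if_splits)
    ultimately show ?thesis using h \<open>x1 \<noteq> a\<close> x2 e by (auto elim!: cases_S)
  qed
  have 1: "bij_betw (\<lambda>(p, q). (snd p, snd q)) ?C ?Z"
    unfolding bij_betw_def
  proof
    show "inj_on (\<lambda>(p, q). (snd p, snd q)) ?C"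
      using same_row by (auto simp: inj_on_def chains_def)
    show "(\<lambda>(p, q). (snd p, snd q)) ` ?C = ?Z"
    proof (intro equalityI subsetI)
      fix w assume "w \<in> ?Z"
      then obtain y z where w: "w = (y, z)" "y \<in> fw.K" "z \<in> fw.Y" "z \<notin> fw.K" "y < z" by blast
      then obtain x where x: "(x, z) \<in> S" "a \<le> x" "x \<le> b" using Y_cell by blast
      have "x \<noteq> a" using x w(3,4) by (auto elim!: cases_S)
      then have "((a, y), (x, z)) \<in> ?C"
        using w x K_cell[of y] K_Y[of y] rect_sub a_le_b fw.Y_sub by (auto simp: chains_def)
      then show "w \<in> (\<lambda>(p, q). (snd p, snd q)) ` ?C" using w(1) by force
    next
      fix w assume "w \<in> (\<lambda>(p, q). (snd p, snd q)) ` ?C"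
      then obtain p q where "(p, q) \<in> ?C" "w = (snd p, snd q)" by auto
      then show "w \<in> ?Z" using C_D[of p q] by simp
    qed
  qed
  \<comment> \<open>The new rows are \<open>rp (snd p)\<close> below
    \<open>ord_rev fw.Y (snd q)\<close>. Reversing \<open>Y\<close> restores the old row of
    \<open>q\<close> and sends that of \<open>p\<close> to a white row above it.\<close>
  have 2: "bij_betw (\<lambda>(p, q). (snd q, ?r (rp (snd p)))) ?C' ?Z"
    unfolding bij_betw_def
  proof
    have inj_r: "y = z" if "y \<in> fw.Y" "z \<in> fw.Y" "?r (rp y) = ?r (rp z)" for y z
      using that rev(2)[of "rp y"] rev(2)[of "rp z"] fw.row_perm_facts(1)[of y]
        fw.row_perm_facts(1)[of z] injD[OF inj_row_perm[OF fw.fin_Y fw.K_sub], of y z] by metis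
    show "inj_on (\<lambda>(p, q). (snd q, ?r (rp (snd p)))) ?C'"
    proof (rule inj_onI)
      fix v w assume v: "v \<in> ?C'" and w: "w \<in> ?C'"
        and eq: "(\<lambda>(p, q). (snd q, ?r (rp (snd p)))) v = (\<lambda>(p, q). (snd q, ?r (rp (snd p)))) w"
      obtain p q p' q' where e: "v = (p, q)" "w = (p', q')" by (metis surj_pair)
      have eqs: "snd q = snd q'" "?r (rp (snd p)) = ?r (rp (snd p'))" using eq e by simp_all
      have "snd p \<in> fw.Y" "snd p' \<in> fw.Y" using C'_D v w unfolding e by blast+
      then have "snd p = snd p'" using eqs(2) by (rule inj_r)
      moreover note eqs(1)
      moreover have "p \<in> S" "q \<in> S" "p' \<in> S" "q' \<in> S"
        using e v w by (auto simp: moved_chains_def)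
      ultimately show "v = w" using e same_row by (metis prod.collapse)
    qed
    show "(\<lambda>(p, q). (snd q, ?r (rp (snd p)))) ` ?C' = ?Z"
    proof (intro equalityI subsetI)
      fix w assume "w \<in> ?Z"
      then obtain y z where w: "w = (y, z)" "y \<in> fw.K" "z \<in> fw.Y" "z \<notin> fw.K" "y < z" by blast
      \<comment> \<open>The old row whose new row is the reversal of \<open>z\<close>.\<close>
      define u where "u = ?pr (?r z)"
      have rp_u: "rp u = ?r z"
        unfolding u_def by (rule row_perm_inverse_image[OF fw.fin_Y fw.K_sub])
      have u: "u \<in> fw.Y" "u \<notin> fw.K"
        using rp_u fw.row_perm_facts(1,2)[of u] rev w by auto
      then obtain x where x: "(x, u) \<in> S" "a \<le> x" "x \<le> b" using Y_cell by blast
      have "x \<noteq> a" using x u by (auto elim!: cases_S)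
      have "y \<in> fw.Y" using w K_Y by blast
      then have "rp u < rp y" using w rev rp_K rp_u by simp
      moreover have "rp u \<in> I" "rp y \<in> I"
        using fw.row_perm_in_I u \<open>y \<in> fw.Y\<close> fw.Y_sub by blast+
      moreover have "mv x < mv a" using x \<open>x \<noteq> a\<close> by (auto simp: mv_def)
      ultimately have "((x, u), (a, y)) \<in> ?C'"
        using x a_le_b K_cell[OF w(2)] rect_sub by (auto simp: moved_chains_def)
      moreover have "?r (rp u) = z" using rp_u rev w by simp
      ultimately show "w \<in> (\<lambda>(p, q). (snd q, ?r (rp (snd p)))) ` ?C'"
        using w(1) by force
    next
      fix w assume "w \<in> (\<lambda>(p, q). (snd q, ?r (rp (snd p)))) ` ?C'"
      then obtain p q where pq: "(p, q) \<in> ?C'" "w = (snd q, ?r (rp (snd p)))" by auto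
      note D = C'_D[OF pq(1)]
      have Y: "rp (snd p) \<in> fw.Y" "snd q \<in> fw.Y" "rp (snd p) \<notin> ?r ` fw.K"
        using D K_Y fw.row_perm_facts by auto
      have "?r (rp (snd p)) \<notin> fw.K"
        using Y rev by (metis imageI)
      moreover have "snd q < ?r (rp (snd p))"
        using D rp_K[of "snd q"] rev(3)[of "?r (rp (snd p))" "snd q"] rev(1,2)[OF Y(1)] Y(2) by simp
      ultimately show "w \<in> ?Z" using pq(2) D Y rev by simp
    qed
  qed
  show ?thesis
    by (rule trans[OF bij_betw_same_card[OF 1] sym[OF bij_betw_same_card[OF 2]]])
qed

lemma mv_less_iff: "a < x \<Longrightarrow> a < x' \<Longrightarrow> mv x < mv x' \<longleftrightarrow> x < x'"
  by (auto simp: mv_def)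

text \<open>As \<open>I\<close> is an interval, a row outside it lies above all of \<open>I\<close>
  or below all of it.\<close>

lemma I_side: "y \<in> I \<Longrightarrow> y' \<in> I \<Longrightarrow> z \<notin> I \<Longrightarrow> y < z \<longleftrightarrow> y' < z"
  using I_convex[of y y' z] I_convex[of y' y z] by (metis linorder_le_cases order_le_less order_less_trans not_less)

text \<open>When \<open>x1 < x2\<close>, each condition is preserved by itself. A row that is
  permuted stays in \<open>I\<close>, and the column of its corner lies in the rectangle, so the
  corner is a cell before and after. When the order of the columns fails, neither side
  holds.\<close>

lemma chain_moved_iff:
  assumes p: "(x1, y1) \<in> S" "x1 \<noteq> a" and q: "(x2, y2) \<in> S" "x2 \<noteq> a"
    and "\<not> (y1 \<in> fw.Y \<and> y2 \<in> I \<and> b < x2)"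
  shows "((x1, y1), (x2, y2)) \<in> moved_chains \<longleftrightarrow> ((x1, y1), (x2, y2)) \<in> chains P S"
proof (cases "x1 < x2")
  case True
  have a: "a < x1" "a < x2" using assms a_le S(1) by (auto simp: order_le_less subset_iff)
  have rpI: "rp y1 \<in> I \<longleftrightarrow> y1 \<in> I" "rp y2 \<in> I \<longleftrightarrow> y2 \<in> I" by (rule fw.row_perm_in_I)+
  have "(x1, rp y2) \<in> P \<longleftrightarrow> (x1, y2) \<in> P"
  proof (cases "y2 \<in> fw.Y")
    case Y: True
    then have "y2 \<in> I" "x2 \<le> b" using q by (auto elim!: cases_S)
    then show ?thesis using rect_sub a True rpI by simp
  qed (simp add: rp_fix)
  moreover have "(x2, rp y1) \<in> P \<longleftrightarrow> (x2, y1) \<in> P"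
  proof (cases "y1 \<in> fw.Y")
    case Y: True
    then have "y1 \<in> I" "x2 \<le> b" using p q assms(5) by (auto elim!: cases_S)
    then show ?thesis using rect_sub a rpI by simp
  qed (simp add: rp_fix)
  moreover have "rp y1 < rp y2 \<longleftrightarrow> y1 < y2"
  proof -
    have K: "y1 \<notin> fw.K" "y2 \<notin> fw.K" using p q fw.mem_K by blast+
    consider "y1 \<in> fw.Y" "y2 \<in> fw.Y" | "y1 \<in> fw.Y" "y2 \<notin> fw.Y" | "y1 \<notin> fw.Y" "y2 \<in> fw.Y"
      | "y1 \<notin> fw.Y" "y2 \<notin> fw.Y" by blast
    then show ?thesis
    proof cases
      case 1 then show ?thesis using K row_perm_less_iff[OF fw.fin_Y fw.K_sub] by simp
    next
      \<comment> \<open>A row of \<open>I\<close> for \<open>y2\<close> would put the second 1 right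
        of the rectangle, which is the excluded first class. So \<open>y2\<close> is outside
        \<open>I\<close>, on one side of both \<open>y1\<close> and \<open>rp y1\<close>.\<close>
      case 2
      then have "y2 \<notin> I" using q assms(5) by (auto elim!: cases_S)
      then show ?thesis using 2 I_side[of y1 "rp y1" y2] rpI fw.Y_sub by (auto simp: rp_fix)
    next
      \<comment> \<open>Here \<open>x1 < x2 \<le> b\<close>, so \<open>y1 \<in> I\<close> would put
        the first 1 into the rectangle and \<open>y1\<close> into \<open>Y\<close>.\<close>
      case 3
      then have "x2 \<le> b" using q by (auto elim!: cases_S)
      then have "y1 \<notin> I" using p 3 True by (auto elim!: cases_S)
      moreover have "y2 \<in> I" using 3 fw.Y_sub by blast
      ultimately have "y2 < y1 \<longleftrightarrow> rp y2 < y1" "y1 \<noteq> y2" "y1 \<noteq> rp y2"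
        using I_side[of y2 "rp y2" y1] rpI by auto
      then show ?thesis using 3 by (auto simp: rp_fix)
    next
      case 4 then show ?thesis by (simp add: rp_fix)
    qed
  qed
  ultimately show ?thesis
    using p q a True by (simp add: chains_def moved_chains_def mv_less_iff)
next
  case False
  have "a < x1" "a < x2" using assms a_le S(1) by (auto simp: order_le_less subset_iff)
  then show ?thesis using False by (simp add: chains_def moved_chains_def mv_less_iff)
qed

text \<open>The first two classes are matched by counting; the pairs in the third class are the same
  before and after.\<close>

lemma card_moved_chains: "card moved_chains = card (chains P S)"
proof -
  let ?D = "\<lambda>p q. snd p \<in> fw.Y \<and> snd q \<in> I \<and> b < fst q"
  let ?E = "\<lambda>p q. fst p = a \<or> fst q = a"
  have split: "card C = card {(p, q) \<in> C. ?D p q} + card {(p, q) \<in> C. \<not> ?D p q \<and> ?E p q} +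
      card {(p, q) \<in> C. \<not> ?D p q \<and> \<not> ?E p q}" if "finite C" for C
  proof -
    let ?A = "{(p, q) \<in> C. ?D p q}" and ?B = "{(p, q) \<in> C. \<not> ?D p q \<and> ?E p q}"
      and ?R = "{(p, q) \<in> C. \<not> ?D p q \<and> \<not> ?E p q}"
    have f: "finite ?A" "finite ?B" "finite ?R" using that by (auto intro: finite_subset)
    have "C = (?A \<union> ?B) \<union> ?R" by blast
    then have "card C = card ((?A \<union> ?B) \<union> ?R)" by (rule arg_cong)
    also have "\<dots> = card (?A \<union> ?B) + card ?R" using f by (intro card_Un_disjoint) auto
    also have "card (?A \<union> ?B) = card ?A + card ?B" using f by (intro card_Un_disjoint) auto
    finally show ?thesis .
  qed
  have fin_C: "finite (chains P S)" "finite moved_chains"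
    by (rule finite_subset[of _ "S \<times> S"]; use finite_S in \<open>auto simp: chains_def moved_chains_def\<close>)+
  have sub: "p \<in> S \<and> q \<in> S" if "(p, q) \<in> chains P S \<or> (p, q) \<in> moved_chains" for p q
    using that by (auto simp: chains_def moved_chains_def)
  have "{(p, q) \<in> moved_chains. \<not> ?D p q \<and> \<not> ?E p q} = {(p, q) \<in> chains P S. \<not> ?D p q \<and> \<not> ?E p q}"
  proof (rule set_eqI)
    fix w :: "cell \<times> cell"
    obtain x1 y1 x2 y2 where w: "w = ((x1, y1), (x2, y2))" by (metis surj_pair)
    show "w \<in> {(p, q) \<in> moved_chains. \<not> ?D p q \<and> \<not> ?E p q} \<longleftrightarrow>
        w \<in> {(p, q) \<in> chains P S. \<not> ?D p q \<and> \<not> ?E p q}"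
      unfolding w using sub[of "(x1, y1)" "(x2, y2)"] chain_moved_iff[of x1 y1 x2 y2] by auto
  qed
  then show ?thesis
    unfolding split[OF fin_C(1)] split[OF fin_C(2)] chains_outer chains_first by simp
qed

lemma card_chains_ones_step: "card (chains (alpha_step P) (ones_step S)) = card (chains P S)"
  by (simp add: card_chains_step card_moved_chains)

end

end


section \<open>Fillings and the induction over the algorithm\<close>

definition one_sets :: "cell set \<Rightarrow> nat list \<Rightarrow> int set \<Rightarrow> cell set set" where
  "one_sets P s A = {S. S \<subseteq> P \<and> one_per_row S \<and> row_coords P - snd ` S = A \<and>
     (\<forall>i < card (col_coords P). card (col S (leftmost P + int i)) = s ! i)}"

lemma one_cells_filling_of: "S \<subseteq> P \<Longrightarrow> one_cells P (filling_of P S) = S"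
  by (auto simp: one_cells_def filling_of_def)

text \<open>On \<open>P\<close> the values are 0 or 1; off \<open>P\<close> both functions are
  \<open>undefined\<close> by extensionality.\<close>

lemma filling_of_one_cells: "F \<in> P \<rightarrow>\<^sub>E {0, 1} \<Longrightarrow> filling_of P (one_cells P F) = F"
  by (rule ext) (auto simp: one_cells_def filling_of_def PiE_def Pi_def extensional_def)

lemma one_per_row_iff_card:
  assumes "finite S"
  shows "one_per_row S \<longleftrightarrow> (\<forall>y. card {x. (x, y) \<in> S} \<le> 1)"
proof -
  have "finite {x. (x, y) \<in> S}" for y
    by (rule finite_subset[of _ "fst ` S"]) (use assms in force)+
  then show ?thesis
    by (simp add: card_le_Suc0_iff_eq one_per_row_def) blast
qed

lemma empty_rows_eq: "empty_rows P F = row_coords P - snd ` one_cells P F"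
  by (force simp: empty_rows_def)

lemma F_set_one_cells:
  assumes "finite P"
  shows "F \<in> F_set P s A \<longleftrightarrow> F \<in> P \<rightarrow>\<^sub>E {0, 1} \<and> one_cells P F \<in> one_sets P s A"
proof -
  have sub: "one_cells P F \<subseteq> P" by (auto simp: one_cells_def)
  then have fin: "finite (one_cells P F)" using assms finite_subset by blast
  show ?thesis
    unfolding F_set_def fillings_def one_sets_def mem_Collect_eq empty_rows_eq
      one_per_row_iff_card[OF fin] col_def
    using sub by blast
qed

lemma bij_betw_one_cells:
  assumes "finite P"
  shows "bij_betw (one_cells P) (F_set P s A) (one_sets P s A)"
    and "bij_betw (filling_of P) (one_sets P s A) (F_set P s A)"
proof -
  have 1: "one_cells P ` F_set P s A \<subseteq> one_sets P s A"
    using F_set_one_cells[OF assms] by blast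
  have 2: "filling_of P ` one_sets P s A \<subseteq> F_set P s A"
  proof
    fix F assume "F \<in> filling_of P ` one_sets P s A"
    then obtain S where S: "F = filling_of P S" "S \<in> one_sets P s A" by blast
    then have "one_cells P F = S" by (simp add: one_sets_def one_cells_filling_of)
    moreover have "F \<in> P \<rightarrow>\<^sub>E {0, 1}" using S by (auto simp: filling_of_def)
    ultimately show "F \<in> F_set P s A" using F_set_one_cells[OF assms] S by blast
  qed
  have 3: "\<forall>F\<in>F_set P s A. filling_of P (one_cells P F) = F"
    using F_set_one_cells[OF assms] by (intro ballI filling_of_one_cells) simp
  have 4: "\<forall>S\<in>one_sets P s A. one_cells P (filling_of P S) = S"
    by (simp add: one_sets_def one_cells_filling_of)
  show "bij_betw (one_cells P) (F_set P s A) (one_sets P s A)"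
    by (rule bij_betw_byWitness[OF 3 4 1 2])
  show "bij_betw (filling_of P) (one_sets P s A) (F_set P s A)"
    by (rule bij_betw_byWitness[OF 4 3 2 1])
qed

context nonempty_moon
begin

section \<open>Column sums and the bijection of one step\<close>

lemma card_lead_rect: "card (col_coords (lead_rect P)) = nat (b - a + 1)"
  using I_nonempty by (simp add: lead_rect_eq col_coords_def)

lemma width_le: "nat (b - a + 1) \<le> card (col_coords P)"
proof -
  have "{a..b} \<subseteq> col_coords P" using col_coords_interval by auto
  moreover have "finite (col_coords P)" using fin by (simp add: col_coords_def)
  ultimately have "card {a..b} \<le> card (col_coords P)" by (rule card_mono[rotated])
  then show ?thesis by (simp add: add.commute)
qed

text \<open>The inverse of \<open>mv\<close> in terms of indices: the column now at position
  \<open>i\<close> was at position \<open>idx i\<close>. The last position of the rectangle received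
  the column of index 0.\<close>

definition "idx i = (if int i < b - a then Suc i else if int i = b - a then 0 else i)"

lemma mv_idx: "mv (a + int (idx i)) = a + int i"
  using a_le_b by (auto simp: idx_def mv_def)

lemma idx_less: "i < card (col_coords P) \<Longrightarrow> idx i < card (col_coords P)"
  using width_le by (auto simp: idx_def)

lemma ex_idx:
  assumes "i < card (col_coords P)"
  shows "\<exists>j < card (col_coords P). idx j = i"
proof -
  consider "i = 0" | "0 < i" "int i \<le> b - a" | "int i > b - a" by linarith
  then show ?thesis
  proof cases
    case 1
    then show ?thesis
      using width_le a_le_b by (intro exI[of _ "nat (b - a)"]) (auto simp: idx_def)
  next
    case 2
    then show ?thesis using assms by (intro exI[of _ "i - 1"]) (auto simp: idx_def)
  next
    case 3
    then show ?thesis using assms by (intro exI[of _ i]) (auto simp: idx_def)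
  qed
qed

lemma length_alpha_step_seq:
  "length s = card (col_coords P) \<Longrightarrow> length (alpha_step_seq P s) = card (col_coords (alpha_step P))"
  by (simp add: alpha_step_seq_def col_coords_alpha Let_def)

lemma nth_alpha_step_seq:
  assumes "length s = card (col_coords P)" "i < card (col_coords P)"
  shows "alpha_step_seq P s ! i = s ! idx i"
proof -
  let ?w = "nat (b - a + 1)"
  have w: "?w \<le> length s" using width_le assms by simp
  show ?thesis
  proof (cases "i < ?w")
    case True
    then have "alpha_step_seq P s ! i = take ?w s ! (Suc i mod ?w)"
      using w by (simp add: alpha_step_seq_def card_lead_rect Let_def nth_append nth_rotate1 min_absorb2)
    also have "\<dots> = s ! idx i"
    proof (cases "int i = b - a")
      case True
      \<comment> \<open>At the last position of the rectangle the index wraps around to 0.\<close>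
      then have "?w = Suc i" by simp
      then show ?thesis using True by (simp add: idx_def)
    next
      case False
      then have "Suc i < ?w" "int i < b - a" using \<open>i < ?w\<close> by auto
      then show ?thesis by (simp add: idx_def)
    qed
    finally show ?thesis .
  next
    case False
    then have "b - a < int i" by linarith
    then show ?thesis
      using False w by (simp add: alpha_step_seq_def card_lead_rect Let_def nth_append min_absorb2 idx_def)
  qed
qed

text \<open>The equivalence serves both directions of the bijection: the column sums and the entries
  of the tuple are reindexed by the same permutation \<open>idx\<close>.\<close>

lemma ones_step_in_iff:
  assumes "S \<subseteq> P" "one_per_row S" "length s = card (col_coords P)"
  shows "ones_step S \<in> one_sets (alpha_step P) (alpha_step_seq P s) A \<longleftrightarrow> S \<in> one_sets P s A"
proof -
  let ?m = "card (col_coords P)"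
  have "card (col (ones_step S) (a + int i)) = card (col S (a + int (idx i)))" for i
    using card_col_ones_step[OF assms(1,2), of "a + int (idx i)"] by (simp add: mv_idx)
  then have "(\<forall>i < ?m. card (col (ones_step S) (a + int i)) = alpha_step_seq P s ! i) \<longleftrightarrow>
      (\<forall>i < ?m. card (col S (a + int (idx i))) = s ! idx i)"
    using nth_alpha_step_seq[OF assms(3)] by simp
  also have "\<dots> \<longleftrightarrow> (\<forall>i < ?m. card (col S (a + int i)) = s ! i)"
    using ex_idx idx_less by metis
  finally show ?thesis
    using assms ones_step_subset[OF assms(1,2)] one_per_row_step[OF assms(1,2)]
    unfolding one_sets_def mem_Collect_eq row_coords_alpha col_coords_alpha leftmost_alpha
      rows_step[OF assms(1,2)] a_def[symmetric] by simp
qed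

lemma ones_back:
  assumes "S' \<subseteq> alpha_step P" "one_per_row S'"
  shows "ones_back S' \<subseteq> P" "one_per_row (ones_back S')" "ones_step (ones_back S') = S'"
proof -
  interpret bw: column_move I a b b a "\<lambda>x. x + 1" "\<lambda>x. x - 1" S'
    by (rule column_move_bw[OF assms])
  show "one_per_row (ones_back S')" by (rule bw.one_per_row_S')
  show "ones_step (ones_back S') = S'" by (rule bw.ones_map_inverse)
  show "ones_back S' \<subseteq> P"
  proof
    fix p assume "p \<in> ones_back S'"
    then have "p \<in> bw.\<theta> ` S'" by (simp only: bw.S'_eq)
    then obtain x y where p: "p = bw.\<theta> (x, y)" "(x, y) \<in> S'" by (elim imageE) auto
    show "p \<in> P"
    \<comment> \<open>Rows of \<open>Y\<close> stay in the rectangle, which lies in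
      \<open>P\<close>. In the other rows the mirrored map is the inverse of the shift in
      \<open>mem_alpha\<close>.\<close>
    proof (cases "y \<in> bw.Y")
      case True
      then have "p \<in> {a..b} \<times> I" using p bw.\<theta>_in_rect[of "(x, y)"] by simp
      then show ?thesis using rect_sub by auto
    next
      case False
      then have "y \<notin> bw.K" using bw.K_sub by blast
      moreover have "(x, y) \<in> alpha_step P" using p(2) assms(1) by blast
      ultimately show ?thesis
        using False by (auto simp: p(1) cell_map_def row_perm_def mem_alpha split: if_splits)
    qed
  qed
qed

lemma bij_betw_ones_step:
  assumes "length s = card (col_coords P)"
  shows "bij_betw ones_step (one_sets P s A) (one_sets (alpha_step P) (alpha_step_seq P s) A)"
proof (rule bij_betw_byWitness[of _ ones_back])
  have D: "S \<subseteq> P \<and> one_per_row S" if "S \<in> one_sets P s A" for S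
    using that by (simp add: one_sets_def)
  have D': "S \<subseteq> alpha_step P \<and> one_per_row S"
    if "S \<in> one_sets (alpha_step P) (alpha_step_seq P s) A" for S
    using that by (simp add: one_sets_def)
  show "\<forall>S\<in>one_sets P s A. ones_back (ones_step S) = S"
    using D back_step by blast
  show "\<forall>S\<in>one_sets (alpha_step P) (alpha_step_seq P s) A. ones_step (ones_back S) = S"
    using D' ones_back(3) by blast
  show "ones_step ` one_sets P s A \<subseteq> one_sets (alpha_step P) (alpha_step_seq P s) A"
    using D ones_step_in_iff[OF _ _ assms] by blast
  show "ones_back ` one_sets (alpha_step P) (alpha_step_seq P s) A \<subseteq> one_sets P s A"
  proof
    fix S assume "S \<in> ones_back ` one_sets (alpha_step P) (alpha_step_seq P s) A"
    then obtain S' where S': "S = ones_back S'" "S' \<in> one_sets (alpha_step P) (alpha_step_seq P s) A"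
      by blast
    then show "S \<in> one_sets P s A"
      using ones_back[of S'] D'[OF S'(2)] ones_step_in_iff[of "ones_back S'" s A] S' assms by simp
  qed
qed

lemma g_step_eq:
  assumes "F \<in> F_set P s A"
  shows "g_step P F = filling_of (alpha_step P) (ones_step (one_cells P F))"
    and "one_cells (alpha_step P) (g_step P F) = ones_step (one_cells P F)"
    and "ne (alpha_step P) (g_step P F) = ne P F"
proof -
  have S: "one_cells P F \<subseteq> P" "one_per_row (one_cells P F)"
    using assms F_set_one_cells[OF fin] by (auto simp: one_sets_def)
  show 1: "g_step P F = filling_of (alpha_step P) (ones_step (one_cells P F))"
    using ones_step_move[OF S] by (simp add: g_step_def Let_def a_def b_def)
  show 2: "one_cells (alpha_step P) (g_step P F) = ones_step (one_cells P F)"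
    unfolding 1 by (rule one_cells_filling_of[OF ones_step_subset[OF S]])
  show "ne (alpha_step P) (g_step P F) = ne P F"
    by (simp add: ne_def ne_chains_eq nonempty_moon.ne_chains_eq[OF nonempty_moon_alpha] 2
        card_chains_ones_step[OF S])
qed

lemma bij_betw_g_step:
  assumes "length s = card (col_coords P)"
  shows "bij_betw (g_step P) (F_set P s A) (F_set (alpha_step P) (alpha_step_seq P s) A)"
proof -
  have "bij_betw (filling_of (alpha_step P) \<circ> (ones_step \<circ> one_cells P)) (F_set P s A)
      (F_set (alpha_step P) (alpha_step_seq P s) A)"
    by (intro bij_betw_trans[OF bij_betw_trans[OF bij_betw_one_cells(1)[OF fin]
      bij_betw_ones_step[OF assms]] bij_betw_one_cells(2)[OF fin_alpha]])
  \<comment> \<open>The composite through sets of 1-cells agrees with \<open>g_step P\<close> on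
    \<open>F_set P s A\<close>, which is enough for the bijection.\<close>
  then show ?thesis
    by (rule bij_betw_cong[THEN iffD1, rotated]) (simp add: g_step_eq(1))
qed

end

section \<open>Iteration of the step\<close>

lemma alpha_unfold: "alpha P = (if left_aligned P then P else alpha (alpha_step P))"
  unfolding alpha_def by (subst while_unfold) simp

lemma alpha_seq_unfold:
  "alpha_seq P s = (if left_aligned P then s else alpha_seq (alpha_step P) (alpha_step_seq P s))"
  unfolding alpha_seq_def by (subst while_unfold) simp

lemma g_map_unfold:
  "g_map P F = (if left_aligned P then F else g_map (alpha_step P) (g_step P F))"
  unfolding g_map_def by (subst while_unfold) simp

theorem proposition5p10:
  fixes M :: "cell set" and m :: nat and s :: "nat list" and A :: "int set"
  assumes "moon_polyomino M"
    and "card (col_coords M) = m"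
    and "length s = m"
    and "A \<subseteq> row_coords M"
  shows "bij_betw (g_map M) (F_set M s A) (F_set (alpha M) (alpha_seq M s) A) \<and>
    (\<forall>F \<in> F_set M s A. ne M F = ne (alpha M) (g_map M F))"
proof -
  have "length s = card (col_coords M)" using assms by simp
  with assms(1) show ?thesis
  \<comment> \<open>Each loop is unfolded by one round. The induction runs over the total distance
    of the cells from the leftmost column, with the tuple varying as it is rotated along with the
    columns.\<close>
  proof (induction "\<Sum>p\<in>M. nat (fst p - leftmost M)" arbitrary: M s rule: less_induct)
    case less
    show ?case
    proof (cases "left_aligned M")
      case True
      have "g_map M = (\<lambda>F. F)" using True g_map_unfold by fastforce
      then show ?thesis using True alpha_unfold[of M] alpha_seq_unfold[of M s] by (simp add: bij_betw_def)
    next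
      case False
      \<comment> \<open>The empty polyomino counts as left-aligned, its condition being
        vacuous.\<close>
      then have "M \<noteq> {}" by (auto simp: left_aligned_def row_coords_def)
      then interpret nonempty_moon M using less.prems by unfold_locales
      let ?M = "alpha_step M" and ?s = "alpha_step_seq M s"
      have IH: "bij_betw (g_map ?M) (F_set ?M ?s A) (F_set (alpha ?M) (alpha_seq ?M ?s) A) \<and>
          (\<forall>F \<in> F_set ?M ?s A. ne ?M F = ne (alpha ?M) (g_map ?M F))"
        by (rule less.hyps[OF sum_offset_alpha[OF False] moon_alpha
              length_alpha_step_seq[OF less.prems(2)]])
      note bij = bij_betw_g_step[OF less.prems(2), of A]
      have g: "g_map M = g_map ?M \<circ> g_step M"
        by (rule ext) (simp add: g_map_unfold[of M] False)
      have "alpha M = alpha ?M" "alpha_seq M s = alpha_seq ?M ?s"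
        using False by (simp_all add: alpha_unfold[of M] alpha_seq_unfold[of M])
      moreover have "ne M F = ne (alpha ?M) (g_map M F)" if "F \<in> F_set M s A" for F
        using IH g_step_eq(3)[OF that] bij_betwE[OF bij] that by (simp add: g)
      ultimately show ?thesis using IH bij_betw_trans[OF bij conjunct1[OF IH]] g by simp
    qed
  qed
qed

end
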